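(* Let $s\in(0,1]$ and $p\in[1,+\infty)$ be such that $sp<N$ and $s\neq p$. Let $\Omega\subset\mathbb{R}^N$ be an open and bounded domain with Lipschitz boundary. Let $\widetilde s\in[0,1]$ and $\widetilde p\in[1,+\infty]$. If $\widetilde s$ and $\widetilde p$ do not satisfy $$0\le\widetilde s<s\qquad\text{and}\qquad 1\le\widetilde p<\frac{Np}{N-(s-\widetilde s)p},$$ then the space $W^{s,p}(\Omega)$ is not compactly embedded in $W^{\widetilde s,\widetilde p}(\Omega)$.
   Context: $N\ge1$ is an integer and functions are real-valued and measurable. For $s\in[0,1]$ and $p\in[1,+\infty)$ define $[u]_{W^{0,p}(\Omega)}:=\|u\|_{L^p(\Omega)}$, $[u]_{W^{1,p}(\Omega)}:=\|\nabla u\|_{L^p(\Omega)}$ (weak gradient) and, for $s\in(0,1)$, $$[u]_{W^{s,p}(\Omega)}:=\left(c_{N,s,p}\iint_{\Omega\times\Omega}\frac{|u(x)-u(y)|^p}{|x-y|^{N+sp}}\,dx\,dy\right)^{1/p},\qquad c_{N,s,p}:=\frac{s\,2^{2s-1}\,\Gamma\left(\frac{ps+p+N-2}{2}\right)}{\pi^{N/2}\,\Gamma(1-s)}.$$ Set $W^{s,p}(\Omega):=\{u\in L^p(\Omega):[u]_{W^{s,p}(\Omega)}<+\infty\}$, with norm $\|u\|_{W^{0,p}(\Omega)}:=\|u\|_{L^p(\Omega)}$ if $s=0$ and $\|u\|_{W^{s,p}(\Omega)}:=\big([u]^p_{W^{s,p}(\Omega)}+\|u\|^p_{L^p(\Omega)}\big)^{1/p}$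 if $s\in(0,1]$. For $p=+\infty$: $W^{0,\infty}(\Omega):=L^\infty(\Omega)$ and, for $s\in(0,1]$, $W^{s,\infty}(\Omega):=C^{0,s}(\Omega)$ with norm $\|u\|_{L^\infty(\Omega)}+\sup_{x\neq y\in\Omega}\frac{|u(x)-u(y)|}{|x-y|^s}$ (functions being identified up to a.e. equality). *)

theory Defs
  imports "HOL-Analysis.Analysis" "HOL-Probability.Essential_Supremum"
begin

text \<open>
  The ambient space is a Euclidean space \<open>'a\<close>, with \<open>N = DIM('a)\<close>. Elements of the function
  spaces are represented by functions \<open>'a \<Rightarrow> real\<close>, of which only the values on \<open>\<Omega>\<close>, up to
  Lebesgue-null sets, matter. All (semi)norms take values in \<^typ>\<open>ennreal\<close>, so that being finite is
  meaningful for every measurable function.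
\<close>

subsection \<open>Lipschitz domains\<close>

text \<open>
  Near each boundary point \<open>\<Omega>\<close> is the strict epigraph, in the direction of a unit vector \<open>e\<close>, of a
  Lipschitz function on the hyperplane \<open>e\<^sup>\<bottom>\<close>; here \<open>x - (x \<bullet> e) *\<^sub>R e\<close> is the projection to
  \<open>e\<^sup>\<bottom>\<close> and \<open>x \<bullet> e\<close> the last coordinate in an orthonormal frame ending in \<open>e\<close>.
\<close>

definition lipschitz_boundary :: "'a::euclidean_space set \<Rightarrow> bool" where
  "lipschitz_boundary \<Omega> \<longleftrightarrow>
     (\<forall>z\<in>frontier \<Omega>. \<exists>r>0. \<exists>e \<gamma> L.
        norm e = 1 \<and> L-lipschitz_on {y. y \<bullet> e = 0} (\<gamma> :: 'a \<Rightarrow> real) \<and>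
        \<Omega> \<inter> ball z r = {x \<in> ball z r. \<gamma> (x - (x \<bullet> e) *\<^sub>R e) < x \<bullet> e})"

definition bounded_lipschitz_domain :: "'a::euclidean_space set \<Rightarrow> bool" where
  "bounded_lipschitz_domain \<Omega> \<longleftrightarrow>
     open \<Omega> \<and> connected \<Omega> \<and> \<Omega> \<noteq> {} \<and> bounded \<Omega> \<and> lipschitz_boundary \<Omega>"

subsection \<open>Lebesgue norms\<close>

definition ennreal_root :: "real \<Rightarrow> ennreal \<Rightarrow> ennreal" where
  "ennreal_root p x = (if x = \<infinity> then \<infinity> else ennreal (enn2real x powr (1 / p)))"

definition ennreal_pow :: "ennreal \<Rightarrow> real \<Rightarrow> ennreal" where
  "ennreal_pow x p = (if x = \<infinity> then \<infinity> else ennreal (enn2real x powr p))"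

definition Lp_norm ::
  "'a::euclidean_space set \<Rightarrow> ereal \<Rightarrow> ('a \<Rightarrow> 'b::real_normed_vector) \<Rightarrow> ennreal" where
  "Lp_norm \<Omega> p u =
     (if p = \<infinity> then esssup (lebesgue_on \<Omega>) (\<lambda>x. ennreal (norm (u x)))
      else ennreal_root (real_of_ereal p)
             (\<integral>\<^sup>+x. ennreal (norm (u x) powr real_of_ereal p) \<partial>lebesgue_on \<Omega>))"

definition Lp_space :: "'a::euclidean_space set \<Rightarrow> ereal \<Rightarrow> ('a \<Rightarrow> real) set" where
  "Lp_space \<Omega> p = {u \<in> borel_measurable (lebesgue_on \<Omega>). Lp_norm \<Omega> p u < \<infinity>}"

subsection \<open>Weak gradients\<close>

primrec Ck :: "nat \<Rightarrow> ('a::euclidean_space \<Rightarrow> real) \<Rightarrow> bool" where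
  "Ck 0 f \<longleftrightarrow> continuous_on UNIV f"
| "Ck (Suc k) f \<longleftrightarrow> (\<forall>x. f differentiable (at x)) \<and>
     (\<forall>b\<in>Basis. Ck k (\<lambda>x. frechet_derivative f (at x) b))"

definition test_function :: "'a::euclidean_space set \<Rightarrow> ('a \<Rightarrow> real) \<Rightarrow> bool" where
  "test_function \<Omega> \<phi> \<longleftrightarrow>
     (\<forall>k. Ck k \<phi>) \<and> compact (closure {x. \<phi> x \<noteq> 0}) \<and> closure {x. \<phi> x \<noteq> 0} \<subseteq> \<Omega>"

definition locally_integrable ::
  "'a::euclidean_space set \<Rightarrow> ('a \<Rightarrow> 'b::euclidean_space) \<Rightarrow> bool" where
  "locally_integrable \<Omega> f \<longleftrightarrow> (\<forall>K. compact K \<and> K \<subseteq> \<Omega> \<longrightarrow> f absolutely_integrable_on K)"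

definition has_weak_gradient ::
  "'a::euclidean_space set \<Rightarrow> ('a \<Rightarrow> real) \<Rightarrow> ('a \<Rightarrow> 'a) \<Rightarrow> bool" where
  "has_weak_gradient \<Omega> u g \<longleftrightarrow>
     locally_integrable \<Omega> u \<and> locally_integrable \<Omega> g \<and>
     (\<forall>\<phi>. test_function \<Omega> \<phi> \<longrightarrow> (\<forall>b\<in>Basis.
        (\<integral>x. u x * frechet_derivative \<phi> (at x) b \<partial>lebesgue_on \<Omega>) =
        - (\<integral>x. \<phi> x * (g x \<bullet> b) \<partial>lebesgue_on \<Omega>)))"

subsection \<open>Fractional Sobolev spaces\<close>

definition sobolev_const :: "nat \<Rightarrow> real \<Rightarrow> real \<Rightarrow> real" where
  "sobolev_const N s p =
     s * 2 powr (2 * s - 1) * Gamma ((p * s + p + real N - 2) / 2) /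
       (pi powr (real N / 2) * Gamma (1 - s))"

text \<open>
  For \<open>s = 1\<close> the infimum ranges over the weak gradients of \<open>u\<close>. These agree almost everywhere in
  \<open>\<Omega>\<close>, so it is \<open>\<parallel>\<nabla>u\<parallel>\<close> if a weak gradient exists, and \<open>\<infinity>\<close> (the infimum of the empty set) otherwise.
\<close>

definition sobolev_seminorm ::
  "'a::euclidean_space set \<Rightarrow> real \<Rightarrow> real \<Rightarrow> ('a \<Rightarrow> real) \<Rightarrow> ennreal" where
  "sobolev_seminorm \<Omega> s p u =
     (if s = 0 then Lp_norm \<Omega> (ereal p) u
      else if s = 1 then (INF g\<in>{g. has_weak_gradient \<Omega> u g}. Lp_norm \<Omega> (ereal p) g)
      else ennreal_root p
        (ennreal (sobolev_const DIM('a) s p) *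
         (\<integral>\<^sup>+(x, y). ennreal (\<bar>u x - u y\<bar> powr p / norm (x - y) powr (real DIM('a) + s * p))
            \<partial>(lebesgue_on \<Omega> \<Otimes>\<^sub>M lebesgue_on \<Omega>))))"

text \<open>
  An almost-everywhere class belongs to \<open>C\<^sup>0\<^sup>,\<^sup>s(\<Omega>)\<close> if it has a Hoelder continuous representative
  \<open>w\<close>. For open \<open>\<Omega>\<close> and \<open>s > 0\<close> such a \<open>w\<close> is unique on \<open>\<Omega>\<close>; all other representatives
  contribute \<open>\<infinity>\<close> to the infimum.
\<close>

definition holder_seminorm :: "'a::euclidean_space set \<Rightarrow> real \<Rightarrow> ('a \<Rightarrow> real) \<Rightarrow> ennreal" where
  "holder_seminorm \<Omega> s u =
     (INF w\<in>{w. AE x in lebesgue_on \<Omega>. w x = u x}.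
        SUP (x, y)\<in>{(x, y). x \<in> \<Omega> \<and> y \<in> \<Omega> \<and> x \<noteq> y}.
          ennreal (\<bar>w x - w y\<bar> / norm (x - y) powr s))"

definition holder_norm :: "'a::euclidean_space set \<Rightarrow> real \<Rightarrow> ('a \<Rightarrow> real) \<Rightarrow> ennreal" where
  "holder_norm \<Omega> s u = Lp_norm \<Omega> \<infinity> u + holder_seminorm \<Omega> s u"

definition holder_space :: "'a::euclidean_space set \<Rightarrow> real \<Rightarrow> ('a \<Rightarrow> real) set" where
  "holder_space \<Omega> s = {u \<in> borel_measurable (lebesgue_on \<Omega>). holder_norm \<Omega> s u < \<infinity>}"

definition sobolev_space ::
  "'a::euclidean_space set \<Rightarrow> real \<Rightarrow> ereal \<Rightarrow> ('a \<Rightarrow> real) set" where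
  "sobolev_space \<Omega> s p =
     (if p = \<infinity> then (if s = 0 then Lp_space \<Omega> \<infinity> else holder_space \<Omega> s)
      else {u \<in> Lp_space \<Omega> p. sobolev_seminorm \<Omega> s (real_of_ereal p) u < \<infinity>})"

definition sobolev_norm ::
  "'a::euclidean_space set \<Rightarrow> real \<Rightarrow> ereal \<Rightarrow> ('a \<Rightarrow> real) \<Rightarrow> ennreal" where
  "sobolev_norm \<Omega> s p u =
     (if s = 0 then Lp_norm \<Omega> p u
      else if p = \<infinity> then holder_norm \<Omega> s u
      else ennreal_root (real_of_ereal p)
        (ennreal_pow (sobolev_seminorm \<Omega> s (real_of_ereal p) u) (real_of_ereal p) +
         ennreal_pow (Lp_norm \<Omega> p u) (real_of_ereal p)))"

subsection \<open>Compact embeddings\<close>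

definition compactly_embedded ::
  "('a \<Rightarrow> real) set \<Rightarrow> (('a \<Rightarrow> real) \<Rightarrow> ennreal) \<Rightarrow>
   ('a \<Rightarrow> real) set \<Rightarrow> (('a \<Rightarrow> real) \<Rightarrow> ennreal) \<Rightarrow> bool" where
  "compactly_embedded X normX Y normY \<longleftrightarrow>
     X \<subseteq> Y \<and>
     (\<exists>C::real. \<forall>u\<in>X. normY u \<le> ennreal C * normX u) \<and>
     (\<forall>U::nat \<Rightarrow> 'a \<Rightarrow> real. (\<forall>k. U k \<in> X) \<and> (\<exists>B::real. \<forall>k. normX (U k) \<le> ennreal B) \<longrightarrow>
        (\<exists>r v. strict_mono (r :: nat \<Rightarrow> nat) \<and> v \<in> Y \<and>
           (\<lambda>k. normY (\<lambda>x. U (r k) x - v x)) \<longlonglongrightarrow> 0))"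

end

theory Submission
  imports Defs
begin

text \<open>
  If \<open>s' < s\<close> and \<open>p'\<close> is at least critical, the bumps \<open>k\<^bsup>(N - s p) / p\<^esup> h(k (x - z))\<close> are bounded in
  \<open>W\<^sup>s\<^sup>,\<^sup>p\<close>, tend to \<open>0\<close> almost everywhere, and keep a norm bounded away from \<open>0\<close> in the target space.
  If \<open>s \<le> s'\<close>, the oscillations \<open>k\<^bsup>-s\<^esup> sin (k x \<bullet> e)\<close> and \<open>k\<^bsup>-s\<^esup> cos (k x \<bullet> e)\<close> are bounded in
  \<open>W\<^sup>s\<^sup>,\<^sup>p\<close> and tend to \<open>0\<close> uniformly; since \<open>sin\<^sup>2 + cos\<^sup>2 = 1\<close> holds pointwise, for each \<open>k\<close> at least one
  of the two has target norm bounded below, without any averaging over the oscillation. In both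
  cases the only possible limit of a subsequence is \<open>0\<close>, which the lower bound excludes.
\<close>

subsection \<open>Limits and almost everywhere equality\<close>

text \<open>Both sequences are measured by three data: an amplitude \<open>A\<close>, a frequency
  \<open>k\<close> and a carrier set \<open>S\<close>. The \<open>p\<close>-th power of the source
  norm is at most a constant times \<open>(A * k powr s) powr p * measure lebesgue S\<close>, while
  lower bounds in the target are governed by \<open>A * k powr s'\<close> and, for finite
  \<open>q\<close> and \<open>s' < 1\<close>, by the volume of the region where the function varies.
  The exponents are read off from this. A bump on a ball of radius \<open>1 / k\<close> has
  amplitude \<open>k powr ((N - s * p) / p)\<close> because this makes the upper bound constant; its
  lower bound is then bounded away from 0 exactly when \<open>q\<close> is at least critical. An
  oscillation fills \<Omega>, so its amplitude is \<open>k powr (- s)\<close>, and the target sees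
  \<open>k powr (s' - s) \<ge> 1\<close>.

  The obstacle is that two target seminorms are infima, over weak gradients at order 1 and over
  representatives in the Hoelder case, so a lower bound must hold for every competitor. Weak
  gradients are controlled by duality with test functions, representatives by choosing points off
  null sets.\<close>

lemma ennreal_root_mono: "0 < p \<Longrightarrow> x \<le> y \<Longrightarrow> ennreal_root p x \<le> ennreal_root p y"
  by (auto simp: ennreal_root_def less_top[symmetric] top_unique
      intro!: ennreal_leI powr_mono2 enn2real_mono)

lemma ennreal_pow_root: "0 < p \<Longrightarrow> ennreal_pow (ennreal_root p x) p = x"
  by (auto simp: ennreal_root_def ennreal_pow_def powr_powr less_top)

lemma ennreal_root_pow: "0 < p \<Longrightarrow> ennreal_root p (ennreal_pow x p) = x"
  by (auto simp: ennreal_root_def ennreal_pow_def powr_powr less_top)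

lemma ennreal_root_ennreal: "ennreal_root p (ennreal c) = ennreal (max 0 c powr (1 / p))"
  by (cases "0 \<le> c") (auto simp: ennreal_root_def ennreal_neg max_def)

lemma Lp_norm_infinity: "Lp_norm \<Omega> \<infinity> u = esssup (lebesgue_on \<Omega>) (\<lambda>x. ennreal (norm (u x)))"
  by (simp add: Lp_norm_def)

lemma Lp_norm_real:
  "Lp_norm \<Omega> (ereal p) u = ennreal_root p (\<integral>\<^sup>+x. ennreal (norm (u x) powr p) \<partial>lebesgue_on \<Omega>)"
  by (simp add: Lp_norm_def)

lemma ereal_ge_1_cases:
  assumes "1 \<le> (q::ereal)"
  obtains "q = \<infinity>" | r where "q = ereal r" "1 \<le> r"
  using assms by (cases q) (auto simp: one_ereal_def)

text \<open>Convergence in the target norm is used for identifying the limit only through the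
  convergence in \<open>L^q\<close> that it implies.\<close>

lemma Lp_norm_le_sobolev_norm:
  assumes "1 \<le> q"
  shows "Lp_norm \<Omega> q u \<le> sobolev_norm \<Omega> s q u"
  using assms
proof (cases rule: ereal_ge_1_cases)
  case 1
  then show ?thesis by (simp add: sobolev_norm_def holder_norm_def)
next
  case (2 r)
  then have "Lp_norm \<Omega> q u = ennreal_root r (ennreal_pow (Lp_norm \<Omega> q u) r)"
    by (simp add: ennreal_root_pow)
  also have "\<dots> \<le> ennreal_root r
      (ennreal_pow (sobolev_seminorm \<Omega> s r u) r + ennreal_pow (Lp_norm \<Omega> q u) r)"
    using 2 by (intro ennreal_root_mono) auto
  finally show ?thesis
    using 2 by (auto simp: sobolev_norm_def)
qed

lemma sobolev_seminorm_le_sobolev_norm: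
  assumes "1 \<le> q" and "s \<noteq> 0"
  shows "sobolev_seminorm \<Omega> s q u \<le> sobolev_norm \<Omega> s (ereal q) u"
proof -
  have "sobolev_seminorm \<Omega> s q u = ennreal_root q (ennreal_pow (sobolev_seminorm \<Omega> s q u) q)"
    using assms by (simp add: ennreal_root_pow)
  also have "\<dots> \<le> ennreal_root q
      (ennreal_pow (sobolev_seminorm \<Omega> s q u) q + ennreal_pow (Lp_norm \<Omega> (ereal q) u) q)"
    using assms by (intro ennreal_root_mono) auto
  finally show ?thesis
    using assms by (auto simp: sobolev_norm_def)
qed

text \<open>Fatou's lemma for finite exponents, uniform convergence off a null set for \<open>q = \<infinity>\<close>.\<close>

lemma Lp_limit_AE_zero:
  fixes U :: "nat \<Rightarrow> 'a::euclidean_space \<Rightarrow> real"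
  assumes q: "1 \<le> q"
    and U[measurable]: "\<And>k. U k \<in> borel_measurable (lebesgue_on \<Omega>)"
    and v[measurable]: "v \<in> borel_measurable (lebesgue_on \<Omega>)"
    and lim: "AE x in lebesgue_on \<Omega>. (\<lambda>k. U k x) \<longlonglongrightarrow> 0"
    and conv: "(\<lambda>k. Lp_norm \<Omega> q (\<lambda>x. U k x - v x)) \<longlonglongrightarrow> 0"
  shows "AE x in lebesgue_on \<Omega>. v x = 0"
  using q
proof (cases rule: ereal_ge_1_cases)
  case 1
  \<comment> \<open>Countably many essential suprema share one exceptional null set, so off it the
    pointwise bound holds for all \<open>k\<close> at once.\<close>
  have "AE x in lebesgue_on \<Omega>. \<forall>k. ennreal (norm (U k x - v x)) \<le> Lp_norm \<Omega> q (\<lambda>x. U k x - v x)"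
    unfolding 1 Lp_norm_infinity AE_all_countable by (intro allI esssup_AE)
  with lim show ?thesis
  proof eventually_elim
    case (elim x)
    have "(\<lambda>k. ennreal (norm (U k x - v x))) \<longlonglongrightarrow> 0"
      using conv by (rule tendsto_sandwich[rotated 3]) (use elim in auto)
    then have "(\<lambda>k. norm (U k x - v x)) \<longlonglongrightarrow> 0"
      by (subst (asm) ennreal_0[symmetric], subst (asm) tendsto_ennreal_iff) auto
    then have "(\<lambda>k. U k x - v x) \<longlonglongrightarrow> 0"
      by (simp only: tendsto_norm_zero_iff)
    moreover have "(\<lambda>k. U k x - v x) \<longlonglongrightarrow> 0 - v x"
      by (intro tendsto_intros elim)
    ultimately show ?case
      using LIMSEQ_unique by fastforce
  qed
next
  case (2 r)
  define I where "I k = (\<integral>\<^sup>+x. ennreal (norm (U k x - v x) powr r) \<partial>lebesgue_on \<Omega>)" for k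
  \<comment> \<open>Monotonicity of the root suffices to return from roots to integrals:
    \<open>I k \<ge> a\<close> would force the root of \<open>I k\<close> above the positive root of
    \<open>a\<close>.\<close>
  have I0: "I \<longlonglongrightarrow> 0"
  proof (rule order_tendstoI)
    fix a :: ennreal assume "0 < a"
    have "0 < ennreal_root r a"
      using \<open>0 < a\<close> by (auto simp: ennreal_root_def enn2real_eq_0_iff zero_less_iff_neq_zero less_top)
    then have "eventually (\<lambda>k. ennreal_root r (I k) < ennreal_root r a) sequentially"
      using order_tendstoD(2)[OF conv] by (simp add: 2 Lp_norm_real I_def)
    then show "eventually (\<lambda>k. I k < a) sequentially"
    proof eventually_elim
      case (elim k)
      then show ?case
        using ennreal_root_mono[of r a "I k"] 2 by (meson leD leI less_le_trans zero_less_one)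
    qed
  qed simp
  have "(\<integral>\<^sup>+x. ennreal (norm (v x) powr r) \<partial>lebesgue_on \<Omega>)
      = (\<integral>\<^sup>+x. liminf (\<lambda>k. ennreal (norm (U k x - v x) powr r)) \<partial>lebesgue_on \<Omega>)"
  proof (rule nn_integral_cong_AE)
    show "AE x in lebesgue_on \<Omega>. ennreal (norm (v x) powr r)
        = liminf (\<lambda>k. ennreal (norm (U k x - v x) powr r))"
      using lim
    proof eventually_elim
      case (elim x)
      have "(\<lambda>k. norm (U k x - v x) powr r) \<longlonglongrightarrow> norm (0 - v x) powr r"
        using 2 by (intro tendsto_powr' tendsto_intros elim) auto
      then have "(\<lambda>k. ennreal (norm (U k x - v x) powr r)) \<longlonglongrightarrow> ennreal (norm (v x) powr r)"
        by simp
      then show ?case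
        by (intro lim_imp_Liminf[symmetric]) auto
    qed
  qed
  also have "\<dots> \<le> liminf I"
    unfolding I_def by (intro nn_integral_liminf) measurable
  also have "\<dots> = 0"
    using I0 by (intro lim_imp_Liminf) auto
  finally have "(\<integral>\<^sup>+x. ennreal (norm (v x) powr r) \<partial>lebesgue_on \<Omega>) = 0"
    by simp
  then have "AE x in lebesgue_on \<Omega>. ennreal (norm (v x) powr r) = 0"
    by (subst (asm) nn_integral_0_iff_AE) auto
  then show ?thesis
    by eventually_elim auto
qed

section \<open>Invariance of the norms under almost everywhere equality\<close>

lemma sobolev_space_measurable:
  "u \<in> sobolev_space \<Omega> s q \<Longrightarrow> u \<in> borel_measurable (lebesgue_on \<Omega>)"
  by (auto simp: sobolev_space_def Lp_space_def holder_space_def split: if_splits)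

lemma Lp_norm_cong_AE:
  assumes [measurable]: "u \<in> borel_measurable (lebesgue_on \<Omega>)" "w \<in> borel_measurable (lebesgue_on \<Omega>)"
    and eq: "AE x in lebesgue_on \<Omega>. u x = w x"
  shows "Lp_norm \<Omega> q u = Lp_norm \<Omega> q w"
proof (cases "q = \<infinity>")
  case True
  then show ?thesis
    unfolding True Lp_norm_infinity using eq by (intro esssup_AE_cong) auto
next
  case False
  have "(\<integral>\<^sup>+x. ennreal (norm (u x) powr real_of_ereal q) \<partial>lebesgue_on \<Omega>) =
      (\<integral>\<^sup>+x. ennreal (norm (w x) powr real_of_ereal q) \<partial>lebesgue_on \<Omega>)"
    using eq by (intro nn_integral_cong_AE) auto
  then show ?thesis
    using False by (simp add: Lp_norm_def)
qed

text \<open>Only integrals of \<open>u\<close> enter the definition: local integrability survives a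
  change on a negligible set, and so does each pairing with a test function.\<close>

lemma has_weak_gradient_cong_AE:
  fixes u w :: "'a::euclidean_space \<Rightarrow> real"
  assumes \<Omega>: "\<Omega> \<in> sets lebesgue"
    and [measurable]: "u \<in> borel_measurable (lebesgue_on \<Omega>)" "w \<in> borel_measurable (lebesgue_on \<Omega>)"
    and eq: "AE x in lebesgue_on \<Omega>. u x = w x"
    and g: "has_weak_gradient \<Omega> u g"
  shows "has_weak_gradient \<Omega> w g"
proof -
  have "locally_integrable \<Omega> w"
    unfolding locally_integrable_def
  proof (intro allI impI)
    fix K assume K: "compact K \<and> K \<subseteq> \<Omega>"
    then have "u absolutely_integrable_on K"
      using g by (auto simp: has_weak_gradient_def locally_integrable_def)
    moreover have "AE x in lebesgue. x \<in> \<Omega> \<longrightarrow> u x = w x"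
      using eq \<Omega> by (simp add: AE_restrict_space_iff)
    then obtain N where N: "\<And>x. x \<in> space lebesgue - N \<Longrightarrow> x \<in> \<Omega> \<longrightarrow> u x = w x" "N \<in> null_sets lebesgue"
      using AE_E3 by blast
    then have "negligible N" by (simp add: negligible_iff_null_sets)
    ultimately show "w absolutely_integrable_on K"
      by (rule absolutely_integrable_spike) (use N K in auto)
  qed
  moreover have "(\<integral>x. w x * frechet_derivative \<phi> (at x) b \<partial>lebesgue_on \<Omega>) =
      (\<integral>x. u x * frechet_derivative \<phi> (at x) b \<partial>lebesgue_on \<Omega>)"
    if "test_function \<Omega> \<phi>" "b \<in> Basis" for \<phi> b
  proof -
    \<comment> \<open>One degree of smoothness makes the directional derivative continuous, hence
      measurable, as the comparison of the two integrals requires.\<close>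
    have "Ck (Suc 0) \<phi>" using that by (auto simp: test_function_def)
    then have "continuous_on UNIV (\<lambda>x. frechet_derivative \<phi> (at x) b)"
      using that by simp
    then have [measurable]: "(\<lambda>x. frechet_derivative \<phi> (at x) b) \<in> borel_measurable (lebesgue_on \<Omega>)"
      using borel_measurable_continuous_onI borel_measurable_subalgebra
      by (metis measurable_completion measurable_lborel2 measurable_restrict_space1)
    show ?thesis
      using eq by (intro integral_cong_AE) auto
  qed
  ultimately show ?thesis
    using g by (simp add: has_weak_gradient_def)
qed

text \<open>The fractional seminorm without its constant and its root. In this form the
  contributions of two functions can be added, which is how the lower bounds are proved.\<close>

definition gagliardo :: "'a::euclidean_space set \<Rightarrow> real \<Rightarrow> real \<Rightarrow> ('a \<Rightarrow> real) \<Rightarrow> ennreal" where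
  "gagliardo \<Omega> s p u =
     (\<integral>\<^sup>+(x, y). ennreal (\<bar>u x - u y\<bar> powr p / norm (x - y) powr (real DIM('a) + s * p))
        \<partial>(lebesgue_on \<Omega> \<Otimes>\<^sub>M lebesgue_on \<Omega>))"

text \<open>By Fubini, the pairs with at least one coordinate in a null set form a null set of the
  product; the finite measure of \<Omega> provides sigma-finiteness.\<close>

lemma gagliardo_cong_AE:
  assumes \<Omega>: "\<Omega> \<in> lmeasurable"
    and [measurable]: "u \<in> borel_measurable (lebesgue_on \<Omega>)" "w \<in> borel_measurable (lebesgue_on \<Omega>)"
    and eq: "AE x in lebesgue_on \<Omega>. u x = w x"
  shows "gagliardo \<Omega> s p u = gagliardo \<Omega> s p w"
proof -
  interpret finite_measure "lebesgue_on \<Omega>"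
    by (rule finite_measure_lebesgue_on[OF \<Omega>])
  interpret pair_sigma_finite "lebesgue_on \<Omega>" "lebesgue_on \<Omega>" ..
  have "AE z in lebesgue_on \<Omega> \<Otimes>\<^sub>M lebesgue_on \<Omega>. u (fst z) = w (fst z) \<and> u (snd z) = w (snd z)"
  proof (rule AE_pair_measure)
    show "{z \<in> space (lebesgue_on \<Omega> \<Otimes>\<^sub>M lebesgue_on \<Omega>). u (fst z) = w (fst z) \<and> u (snd z) = w (snd z)}
        \<in> sets (lebesgue_on \<Omega> \<Otimes>\<^sub>M lebesgue_on \<Omega>)"
      by measurable
    show "AE x in lebesgue_on \<Omega>. AE y in lebesgue_on \<Omega>.
        u (fst (x, y)) = w (fst (x, y)) \<and> u (snd (x, y)) = w (snd (x, y))"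
      using eq by eventually_elim (use eq in eventually_elim, auto)
  qed
  then show ?thesis
    unfolding gagliardo_def by (intro nn_integral_cong_AE) (auto elim: eventually_mono)
qed

lemma holder_seminorm_cong_AE:
  assumes eq: "AE x in lebesgue_on \<Omega>. u x = w x"
  shows "holder_seminorm \<Omega> s u = holder_seminorm \<Omega> s w"
proof -
  have "{f. AE x in lebesgue_on \<Omega>. f x = u x} = {f. AE x in lebesgue_on \<Omega>. f x = w x}"
    using eq by (auto elim: eventually_elim2)
  then show ?thesis
    by (simp add: holder_seminorm_def)
qed

lemma sobolev_norm_cong_AE:
  assumes \<Omega>: "\<Omega> \<in> lmeasurable"
    and u: "u \<in> borel_measurable (lebesgue_on \<Omega>)" and w: "w \<in> borel_measurable (lebesgue_on \<Omega>)"
    and eq: "AE x in lebesgue_on \<Omega>. u x = w x"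
  shows "sobolev_norm \<Omega> s q u = sobolev_norm \<Omega> s q w"
proof -
  have "has_weak_gradient \<Omega> u = has_weak_gradient \<Omega> w"
    using has_weak_gradient_cong_AE[OF fmeasurableD[OF \<Omega>] u w eq]
      has_weak_gradient_cong_AE[OF fmeasurableD[OF \<Omega>] w u] eq
    by (auto simp: fun_eq_iff eq_commute)
  then have "sobolev_seminorm \<Omega> s r u = sobolev_seminorm \<Omega> s r w" for r
    using Lp_norm_cong_AE[OF u w eq] gagliardo_cong_AE[OF \<Omega> u w eq]
    by (simp add: sobolev_seminorm_def gagliardo_def)
  then show ?thesis
    using Lp_norm_cong_AE[OF u w eq] holder_seminorm_cong_AE[OF eq]
    by (simp add: sobolev_norm_def holder_norm_def)
qed

text \<open>Only the sequential clause of compactness is refuted. Almost everywhere convergence to 0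
  is enough to identify the limit, so the sequence may blow up on a null set, as the bumps do at
  their centre.\<close>

lemma not_compactly_embeddedI:
  fixes U :: "nat \<Rightarrow> 'a::euclidean_space \<Rightarrow> real"
  assumes \<Omega>: "\<Omega> \<in> lmeasurable" and q: "1 \<le> q" and c: "0 < c"
    and UX: "\<And>k. U k \<in> sobolev_space \<Omega> s p"
    and bdd: "\<And>k. sobolev_norm \<Omega> s p (U k) \<le> ennreal B"
    and lower: "\<And>k. c \<le> sobolev_norm \<Omega> s' q (U k)"
    and lim: "AE x in lebesgue_on \<Omega>. (\<lambda>k. U k x) \<longlonglongrightarrow> 0"
  shows "\<not> compactly_embedded (sobolev_space \<Omega> s p) (sobolev_norm \<Omega> s p)
            (sobolev_space \<Omega> s' q) (sobolev_norm \<Omega> s' q)"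
proof
  assume "compactly_embedded (sobolev_space \<Omega> s p) (sobolev_norm \<Omega> s p)
            (sobolev_space \<Omega> s' q) (sobolev_norm \<Omega> s' q)"
  then obtain r v where r: "strict_mono (r :: nat \<Rightarrow> nat)" and v: "v \<in> sobolev_space \<Omega> s' q"
    and conv: "(\<lambda>k. sobolev_norm \<Omega> s' q (\<lambda>x. U (r k) x - v x)) \<longlonglongrightarrow> 0"
    using UX bdd unfolding compactly_embedded_def by blast
  have mU[measurable]: "U k \<in> borel_measurable (lebesgue_on \<Omega>)" for k
    by (rule sobolev_space_measurable[OF UX])
  have mv[measurable]: "v \<in> borel_measurable (lebesgue_on \<Omega>)"
    by (rule sobolev_space_measurable[OF v])
  have "AE x in lebesgue_on \<Omega>. v x = 0"
  proof (rule Lp_limit_AE_zero[OF q _ mv])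
    show "AE x in lebesgue_on \<Omega>. (\<lambda>k. U (r k) x) \<longlonglongrightarrow> 0"
      using lim by eventually_elim (rule LIMSEQ_subseq_LIMSEQ[OF _ r, unfolded o_def])
    show "(\<lambda>k. Lp_norm \<Omega> q (\<lambda>x. U (r k) x - v x)) \<longlonglongrightarrow> 0"
      by (rule tendsto_sandwich[OF _ _ tendsto_const conv])
        (auto intro!: always_eventually Lp_norm_le_sobolev_norm[OF q])
  qed (rule mU)
  \<comment> \<open>The limit \<open>v\<close> vanishes only almost everywhere, so removing it from
    the norm rests on the invariance just proved.\<close>
  then have "sobolev_norm \<Omega> s' q (\<lambda>x. U (r k) x - v x) = sobolev_norm \<Omega> s' q (U (r k))" for k
    by (intro sobolev_norm_cong_AE[OF \<Omega>]) (auto elim: eventually_mono)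
  then have "(\<lambda>k. sobolev_norm \<Omega> s' q (U (r k))) \<longlonglongrightarrow> 0"
    using conv by simp
  then have "c \<le> 0"
    by (rule tendsto_lowerbound) (use lower in auto)
  with c show False by simp
qed

subsection \<open>Classical gradients are weak gradients\<close>

text \<open>The derivative is kept as a vector field, the form in which
  \<open>has_weak_gradient\<close> and the norm of the gradient expect it.\<close>

definition C1_gradient :: "('a::euclidean_space \<Rightarrow> real) \<Rightarrow> ('a \<Rightarrow> 'a) \<Rightarrow> bool" where
  "C1_gradient u G \<longleftrightarrow> (\<forall>x. (u has_derivative (\<lambda>h. G x \<bullet> h)) (at x)) \<and> continuous_on UNIV G"

lemma C1_gradient_has_derivative:
  "C1_gradient u G \<Longrightarrow> (u has_derivative (\<lambda>h. G x \<bullet> h)) (at x within S)"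
  by (auto simp: C1_gradient_def intro: has_derivative_at_withinI)

lemma C1_gradient_continuous: "C1_gradient u G \<Longrightarrow> continuous_on S u"
  by (rule has_derivative_continuous_on) (rule C1_gradient_has_derivative)

lemma C1_gradient_lipschitz:
  assumes "C1_gradient u G" and "\<And>x. norm (G x) \<le> L"
  shows "\<bar>u x - u y\<bar> \<le> L * norm (x - y)"
proof -
  have "norm (u x - u y) \<le> L * norm (x - y)"
  proof (rule differentiable_bound[of UNIV u "\<lambda>x h. G x \<bullet> h"])
    fix x
    have "norm (G x \<bullet> h) \<le> norm (G x) * norm h" for h
      by (simp add: Cauchy_Schwarz_ineq2)
    then show "onorm (\<lambda>h. G x \<bullet> h) \<le> L"
      using assms(2) by (meson onorm_bound order_trans norm_ge_zero)
  qed (use assms in \<open>auto intro: C1_gradient_has_derivative\<close>)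
  then show ?thesis by simp
qed

lemma integrable_continuous_bounded_support:
  fixes f :: "'a::euclidean_space \<Rightarrow> real"
  assumes f: "continuous_on UNIV f" and supp: "\<And>x. R < norm x \<Longrightarrow> f x = 0"
  shows "integrable lborel f"
proof -
  have "integrable lborel (\<lambda>x. indicator (cball 0 R) x *\<^sub>R f x)"
    by (intro borel_integrable_compact continuous_on_subset[OF f]) auto
  also have "(\<lambda>x. indicator (cball 0 R) x *\<^sub>R f x) = f"
    using supp by (auto simp: indicator_def fun_eq_iff)
  finally show ?thesis .
qed

text \<open>The translates of \<open>F\<close> have the same integral, so all difference quotients integrate to \<open>0\<close>.\<close>

lemma integral_directional_derivative_eq_0:
  fixes F :: "'a::euclidean_space \<Rightarrow> real"
  assumes F: "\<And>x. (F has_derivative F' x) (at x)"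
    and cont: "continuous_on UNIV (\<lambda>x. F' x b)"
    and supp: "\<And>x. R < norm x \<Longrightarrow> F x = 0"
  shows "(\<integral>x. F' x b \<partial>lborel) = 0"
proof -
  have lin: "linear (F' x)" for x
    using F has_derivative_linear by blast
  have contF: "continuous_on UNIV F"
    by (rule has_derivative_continuous_on) (rule has_derivative_at_withinI[OF F])
  have supp': "F' x b = 0" if "R < norm x" for x
  proof -
    have "open {x::'a. R < norm x}"
      by (intro open_Collect_less continuous_intros)
    then have "(F has_derivative (\<lambda>h. 0)) (at x)"
      using that supp by (intro has_derivative_transform_within_open[OF has_derivative_const[of 0]]) auto
    then show ?thesis
      using has_derivative_unique[OF F[of x]] by simp
  qed
  have "compact ((\<lambda>x. F' x b) ` cball 0 R)"
    by (intro compact_continuous_image continuous_on_subset[OF cont]) auto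
  then obtain M where "0 < M" and "\<forall>z \<in> (\<lambda>x. F' x b) ` cball 0 R. norm z \<le> M"
    using compact_imp_bounded bounded_pos by metis
  then have M: "\<bar>F' x b\<bar> \<le> M" for x
    using supp'[of x] by (cases "norm x \<le> R") auto
  \<comment> \<open>Steps at most 1 keep the supports of all difference quotients in the common ball
    of radius \<open>R + norm b\<close>, which is what domination needs.\<close>
  define h :: "nat \<Rightarrow> real" where "h n = 1 / real (Suc n)" for n
  have h: "0 < h n" "h n \<le> 1" for n by (auto simp: h_def)
  have h0: "h \<longlonglongrightarrow> 0"
    unfolding h_def using LIMSEQ_inverse_real_of_nat by (simp add: inverse_eq_divide)
  define q where "q n x = (F (x + h n *\<^sub>R b) - F x) / h n" for n x
  have line: "((\<lambda>t. F (x + t *\<^sub>R b)) has_real_derivative F' (x + t *\<^sub>R b) b) (at t within S)" for x t S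
  proof -
    have "((\<lambda>t. F (x + t *\<^sub>R b)) has_derivative (\<lambda>s. F' (x + t *\<^sub>R b) (s *\<^sub>R b))) (at t)"
      by (rule has_derivative_compose[OF _ F]) (auto intro!: derivative_eq_intros)
    moreover have "(\<lambda>s. F' (x + t *\<^sub>R b) (s *\<^sub>R b)) = (*) (F' (x + t *\<^sub>R b) b)"
      by (simp add: fun_eq_iff linear_scale[OF lin] mult.commute)
    ultimately show ?thesis
      unfolding has_field_derivative_def by (simp add: has_derivative_at_withinI)
  qed
  have q_lim: "(\<lambda>n. q n x) \<longlonglongrightarrow> F' x b" for x
  proof -
    have "((\<lambda>t. (F (x + t *\<^sub>R b) - F x) / t) \<longlongrightarrow> F' x b) (at 0)"
      using line[of x 0 UNIV] by (simp add: has_field_derivative_iff)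
    moreover have "filterlim h (at 0) sequentially"
      using h0 h by (auto simp: filterlim_at less_imp_neq[symmetric] intro!: always_eventually)
    ultimately show ?thesis
      unfolding q_def by (rule filterlim_compose)
  qed
  \<comment> \<open>The dominating function: the mean value inequality gives \<open>M\<close> inside
    the ball, and outside it both \<open>x\<close> and its translate leave the support of
    \<open>F\<close>.\<close>
  have q_bound: "norm (q n x) \<le> M * indicator (cball 0 (R + norm b)) x" for n x
  proof (cases "norm x \<le> R + norm b")
    case True
    have "norm (F (x + h n *\<^sub>R b) - F (x + 0 *\<^sub>R b)) \<le> M * norm (h n - 0)"
      by (rule field_differentiable_bound[of UNIV "\<lambda>t. F (x + t *\<^sub>R b)" "\<lambda>t. F' (x + t *\<^sub>R b) b"])
        (auto simp: M line)
    then show ?thesis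
      using True h[of n] by (simp add: q_def field_simps)
  next
    case False
    have "norm (h n *\<^sub>R b) \<le> norm b"
      using h[of n] by (simp add: mult_left_le_one_le)
    then have "R < norm (x + h n *\<^sub>R b)"
      using False norm_triangle_ineq2[of x "- (h n *\<^sub>R b)"] by auto
    moreover have "R < norm x"
      using False norm_ge_zero[of b] by linarith
    ultimately show ?thesis
      using False by (simp add: q_def supp)
  qed
  have intF: "integrable lborel F"
    by (rule integrable_continuous_bounded_support[OF contF supp])
  have trans: "integrable lborel (\<lambda>x. F (x + c))" "(\<integral>x. F (x + c) \<partial>lborel) = (\<integral>x. F x \<partial>lborel)" for c
  proof -
    have F_meas: "F \<in> borel_measurable borel"
      using contF by (rule borel_measurable_continuous_onI)
    have "integrable (distr lborel borel ((+) c)) F"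
      using intF by (simp add: lborel_distr_plus)
    then show "integrable lborel (\<lambda>x. F (x + c))"
      by (subst (asm) integrable_distr_eq) (auto simp: add.commute F_meas)
    have "(\<integral>x. F x \<partial>lborel) = (\<integral>x. F x \<partial>distr lborel borel ((+) c))"
      by (simp add: lborel_distr_plus)
    also have "\<dots> = (\<integral>x. F (x + c) \<partial>lborel)"
      by (subst integral_distr) (auto simp: add.commute F_meas)
    finally show "(\<integral>x. F (x + c) \<partial>lborel) = (\<integral>x. F x \<partial>lborel)" by simp
  qed
  have "(\<lambda>n. \<integral>x. q n x \<partial>lborel) \<longlonglongrightarrow> (\<integral>x. F' x b \<partial>lborel)"
  proof (rule integral_dominated_convergence)
    show "integrable lborel (\<lambda>x. M * indicator (cball (0::'a) (R + norm b)) x)"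
      by (intro integrable_mult_right integrable_real_indicator emeasure_bounded_finite) auto
    show "(\<lambda>x. F' x b) \<in> borel_measurable lborel"
      using borel_measurable_continuous_onI[OF cont] by simp
    show "q n \<in> borel_measurable lborel" for n
      using trans(1)[of "h n *\<^sub>R b"] intF unfolding q_def[abs_def]
      by (intro borel_measurable_divide borel_measurable_diff) auto
  qed (intro AE_I2 q_lim q_bound)+
  moreover have "(\<integral>x. q n x \<partial>lborel) = 0" for n
    using trans[of "h n *\<^sub>R b"] intF by (simp add: q_def)
  ultimately show ?thesis
    by (simp add: LIMSEQ_const_iff)
qed

lemma absolutely_integrable_continuous_compact:
  fixes f :: "'a::euclidean_space \<Rightarrow> 'b::euclidean_space"
  assumes f: "continuous_on UNIV f" and K: "compact K"
  shows "f absolutely_integrable_on K"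
proof -
  obtain a b where ab: "K \<subseteq> cbox a b"
    using K compact_imp_bounded bounded_subset_cbox_symmetric by metis
  have "f absolutely_integrable_on cbox a b"
    by (intro absolutely_integrable_continuous continuous_on_subset[OF f]) auto
  then show ?thesis
    by (rule set_integrable_subset) (use ab K in \<open>auto simp: compact_imp_closed\<close>)
qed

text \<open>Moves an integral over \<Omega> to the whole space, where translation invariance is
  available.\<close>

lemma integral_lebesgue_on_eq_lborel:
  fixes f :: "'a::euclidean_space \<Rightarrow> real"
  assumes "\<Omega> \<in> sets lebesgue" and "f \<in> borel_measurable borel" and "\<And>x. x \<notin> \<Omega> \<Longrightarrow> f x = 0"
  shows "(\<integral>x. f x \<partial>lebesgue_on \<Omega>) = (\<integral>x. f x \<partial>lborel)"
proof -
  have "(\<integral>x. f x \<partial>lebesgue_on \<Omega>) = (\<integral>x. indicator \<Omega> x *\<^sub>R f x \<partial>lebesgue)"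
    using assms by (intro integral_restrict_space) auto
  also have "(\<lambda>x. indicator \<Omega> x *\<^sub>R f x) = f"
    using assms(3) by (auto simp: indicator_def fun_eq_iff)
  also have "(\<integral>x. f x \<partial>lebesgue) = (\<integral>x. f x \<partial>lborel)"
    using assms(2) by (intro integral_completion) simp
  finally show ?thesis .
qed

text \<open>The support is closed, so off it the function is locally zero and its derivative
  vanishes as well.\<close>

lemma test_functionD:
  assumes "test_function \<Omega> \<phi>"
  shows "(\<phi> has_derivative frechet_derivative \<phi> (at x)) (at x)"
    and "b \<in> Basis \<Longrightarrow> continuous_on UNIV (\<lambda>x. frechet_derivative \<phi> (at x) b)"
    and "x \<notin> \<Omega> \<Longrightarrow> \<phi> x = 0"
    and "x \<notin> \<Omega> \<Longrightarrow> frechet_derivative \<phi> (at x) b = 0"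
    and "\<exists>R. \<forall>x. R < norm x \<longrightarrow> \<phi> x = 0 \<and> frechet_derivative \<phi> (at x) b = 0"
proof -
  define K where "K = closure {x. \<phi> x \<noteq> 0}"
  have K: "compact K" "K \<subseteq> \<Omega>"
    using assms by (auto simp: test_function_def K_def)
  have out: "\<phi> x = 0" if "x \<notin> K" for x
    using that closure_subset[of "{x. \<phi> x \<noteq> 0}"] by (auto simp: K_def)
  have "Ck (Suc 0) \<phi>"
    using assms by (simp add: test_function_def)
  then show d: "(\<phi> has_derivative frechet_derivative \<phi> (at x)) (at x)"
    and "b \<in> Basis \<Longrightarrow> continuous_on UNIV (\<lambda>x. frechet_derivative \<phi> (at x) b)" for x
    by (auto simp: frechet_derivative_works)
  have out': "frechet_derivative \<phi> (at x) b = 0" if "x \<notin> K" for x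
  proof -
    have "open (- K)" by (auto simp: K_def)
    then have "(\<phi> has_derivative (\<lambda>h. 0)) (at x)"
      by (rule has_derivative_transform_within_open[OF has_derivative_const[of 0]])
        (use that out in auto)
    then show ?thesis
      using has_derivative_unique[OF d[of x]] by simp
  qed
  show "x \<notin> \<Omega> \<Longrightarrow> \<phi> x = 0" "x \<notin> \<Omega> \<Longrightarrow> frechet_derivative \<phi> (at x) b = 0"
    using K(2) out out' by auto
  obtain R where "\<And>x. x \<in> K \<Longrightarrow> norm x \<le> R"
    using compact_imp_bounded[OF K(1)] by (auto simp: bounded_iff)
  then show "\<exists>R. \<forall>x. R < norm x \<longrightarrow> \<phi> x = 0 \<and> frechet_derivative \<phi> (at x) b = 0"
    using out out' by (meson leD)
qed

text \<open>Integration by parts: the product of \<open>u\<close> and a test function has bounded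
  support, so its directional derivative integrates to 0, and the product rule splits this into the
  two pairings.\<close>

lemma has_weak_gradient_C1:
  assumes u: "C1_gradient u G" and \<Omega>: "\<Omega> \<in> sets lebesgue"
  shows "has_weak_gradient \<Omega> u G"
proof -
  have contG: "continuous_on UNIV G" and contu: "continuous_on UNIV u"
    using u C1_gradient_continuous by (auto simp: C1_gradient_def)
  have "(\<integral>x. u x * frechet_derivative \<phi> (at x) b \<partial>lebesgue_on \<Omega>) =
        - (\<integral>x. \<phi> x * (G x \<bullet> b) \<partial>lebesgue_on \<Omega>)"
    if \<phi>: "test_function \<Omega> \<phi>" and b: "b \<in> Basis" for \<phi> b
  proof -
    note T = test_functionD[OF \<phi>]
    obtain R where R: "\<And>x. R < norm x \<Longrightarrow> \<phi> x = 0 \<and> frechet_derivative \<phi> (at x) b = 0"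
      using T(5) by blast
    have cont\<phi>: "continuous_on UNIV \<phi>"
      by (rule has_derivative_continuous_on) (rule has_derivative_at_withinI[OF T(1)])
    have c1: "continuous_on UNIV (\<lambda>x. u x * frechet_derivative \<phi> (at x) b)"
      and c2: "continuous_on UNIV (\<lambda>x. \<phi> x * (G x \<bullet> b))"
      by (intro continuous_intros contu contG cont\<phi> T(2) b)+
    have i1: "integrable lborel (\<lambda>x. u x * frechet_derivative \<phi> (at x) b)"
      and i2: "integrable lborel (\<lambda>x. \<phi> x * (G x \<bullet> b))"
      by (rule integrable_continuous_bounded_support[OF c1, of R] integrable_continuous_bounded_support[OF c2, of R];
        simp add: R)+
    have "(\<integral>x. u x * frechet_derivative \<phi> (at x) b + (G x \<bullet> b) * \<phi> x \<partial>lborel) = 0"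
    proof (rule integral_directional_derivative_eq_0[where R = R])
      show "((\<lambda>x. u x * \<phi> x) has_derivative
          (\<lambda>h. u x * frechet_derivative \<phi> (at x) h + (G x \<bullet> h) * \<phi> x)) (at x)" for x
        by (intro has_derivative_mult T(1) C1_gradient_has_derivative[OF u])
      show "continuous_on UNIV (\<lambda>x. u x * frechet_derivative \<phi> (at x) b + (G x \<bullet> b) * \<phi> x)"
        using continuous_on_add[OF c1 c2] by (simp add: mult.commute)
    qed (simp add: R)
    then have "(\<integral>x. u x * frechet_derivative \<phi> (at x) b \<partial>lborel) = - (\<integral>x. \<phi> x * (G x \<bullet> b) \<partial>lborel)"
      using i1 i2 by (simp add: mult.commute[of "G _ \<bullet> b"])
    moreover have "(\<integral>x. u x * frechet_derivative \<phi> (at x) b \<partial>lebesgue_on \<Omega>)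
        = (\<integral>x. u x * frechet_derivative \<phi> (at x) b \<partial>lborel)"
      by (intro integral_lebesgue_on_eq_lborel \<Omega> borel_measurable_continuous_onI c1) (simp add: T(4))
    moreover have "(\<integral>x. \<phi> x * (G x \<bullet> b) \<partial>lebesgue_on \<Omega>) = (\<integral>x. \<phi> x * (G x \<bullet> b) \<partial>lborel)"
      by (intro integral_lebesgue_on_eq_lborel \<Omega> borel_measurable_continuous_onI c2) (simp add: T(3))
    ultimately show ?thesis by simp
  qed
  then show ?thesis
    using contu contG
    by (auto simp: has_weak_gradient_def locally_integrable_def intro: absolutely_integrable_continuous_compact)
qed

subsection \<open>The Gagliardo kernel\<close>

lemma emeasure_lborel_ball:
  fixes c :: "'a::euclidean_space"
  assumes "0 < r"
  shows "emeasure lborel (ball c r) = ennreal (measure lborel (ball (0::'a) 1) * r powr real DIM('a))"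
proof -
  have "emeasure lborel (ball c r) = ennreal (measure lborel (ball c r))"
    using emeasure_lborel_ball_finite[of c r] by (subst emeasure_eq_ennreal_measure) auto
  also have "measure lborel (ball c r) = measure lborel (ball (0::'a) 1) * r powr real DIM('a)"
    using assms by (subst content_ball_conv_unit_ball) (auto simp: powr_realpow mult.commute)
  finally show ?thesis .
qed

lemma dyadic_bracket:
  assumes "1 \<le> (t::real)"
  obtains n :: nat where "2 powr n \<le> t" "t < 2 powr (n + 1)"
proof -
  define n where "n = nat \<lfloor>log 2 t\<rfloor>"
  have "0 \<le> log 2 t"
    using assms by simp
  then have "real n \<le> log 2 t" "log 2 t < real n + 1"
    by (simp_all add: n_def)
  then show thesis
    using assms by (intro that[of n]) (simp_all add: powr_le_iff less_powr_iff)
qed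

text \<open>The ratios \<open>2 powr (- s p)\<close> and \<open>2 powr (- (p - s p))\<close> come from the dyadic shells outside and
  inside the ball of radius \<open>1 / k\<close>; both are less than \<open>1\<close> exactly because \<open>0 < s < 1\<close>.\<close>

lemma nn_integral_gagliardo_kernel:
  fixes s p :: real
  assumes s: "0 < s" "s < 1" and p: "1 \<le> p"
  shows "\<exists>C\<ge>0. \<forall>k>0. \<forall>x::'a::euclidean_space.
      (\<integral>\<^sup>+y. ennreal (min 1 (k * norm (x - y)) powr p / norm (x - y) powr (real DIM('a) + s * p)) \<partial>lebesgue)
        \<le> ennreal (C * k powr (s * p))"
proof -
  define N where "N = real DIM('a)"
  define \<omega> where "\<omega> = measure lborel (ball (0::'a) 1)"
  define A where "A n = \<omega> * 2 powr N * (2 powr - (s * p)) ^ n" for n :: nat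
  define B where "B n = \<omega> * 2 powr (2 * N + s * p) * (2 powr - (p - s * p)) ^ n" for n :: nat
  define C where "C = (\<Sum>n. A n + B n)"
  have N: "0 < N" by (simp add: N_def)
  have \<omega>: "0 \<le> \<omega>" by (simp add: \<omega>_def)
  have sp: "0 < s * p" "s * p < p" using s p by auto
  have "summable A" "summable B"
    unfolding A_def B_def using sp
    by (auto intro!: summable_mult summable_geometric simp: powr_less_one)
  then have summ: "summable (\<lambda>n. A n + B n)" by (rule summable_add)
  have AB: "0 \<le> A n" "0 \<le> B n" for n using \<omega> by (auto simp: A_def B_def)
  have "0 \<le> C" unfolding C_def by (intro suminf_nonneg summ add_nonneg_nonneg AB)
  moreover have "(\<integral>\<^sup>+y. ennreal (min 1 (k * norm (x - y)) powr p / norm (x - y) powr (real DIM('a) + s * p)) \<partial>lebesgue)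
        \<le> ennreal (C * k powr (s * p))" if k: "0 < k" for k and x :: 'a
  proof -
    define K where "K y = min 1 (k * norm (x - y)) powr p / norm (x - y) powr (N + s * p)" for y
    define a where "a n = (k / 2 powr real n) powr (N + s * p)" for n :: nat
    define b where "b n = 2 powr (- (real n * p)) * (2 powr (real n + 1) * k) powr (N + s * p)" for n :: nat
    \<comment> \<open>Full balls replace the shells, at the price of a constant factor. The inner
      radius is \<open>2 powr (1 - real n) / k\<close>, twice that of the shell, because the balls
      are open and \<open>k * d = 2 powr - real n\<close> may occur.\<close>
    define g where "g n y = ennreal (a n) * indicator (ball x (2 powr (real n + 1) / k)) y
        + ennreal (b n) * indicator (ball x (2 powr (1 - real n) / k)) y" for n y
    have K_le: "ennreal (K y) \<le> (\<Sum>n. g n y)" for y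
    proof -
      define d where "d = norm (x - y)"
      have "\<exists>n. ennreal (K y) \<le> g n y"
      proof (cases "d = 0")
        \<comment> \<open>On the diagonal the numerator is \<open>0 powr p = 0\<close>, and the
          quotient is 0 by the convention on division.\<close>
        case True
        then show ?thesis by (simp add: K_def d_def)
      next
        case False
        then have d: "0 < d" by (simp add: d_def)
        have dist: "dist x y = d" by (simp add: d_def dist_norm)
        show ?thesis
        proof (cases "1 \<le> k * d")
          case True
          then obtain n :: nat where n: "2 powr n \<le> k * d" "k * d < 2 powr (n + 1)"
            by (rule dyadic_bracket)
          have "K y = (1 / d) powr (N + s * p)"
            using True d by (simp add: K_def d_def[symmetric] powr_divide)
          also have "\<dots> \<le> a n"
            unfolding a_def using n d k N sp by (intro powr_mono2) (auto simp: field_simps)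
          also have "ennreal (a n) \<le> g n y"
            using n k by (simp add: g_def dist indicator_def field_simps)
          finally show ?thesis by (auto simp: ennreal_leI)
        next
          case False
          then have "1 \<le> 1 / (k * d)" using k d by simp
          then obtain n :: nat where "2 powr n \<le> 1 / (k * d)" "1 / (k * d) < 2 powr (n + 1)"
            by (rule dyadic_bracket)
          then have n: "k * d \<le> 2 powr - real n" "1 / d \<le> 2 powr (real n + 1) * k"
            using k d by (auto simp: field_simps powr_minus)
          have "K y = (k * d) powr p * (1 / d) powr (N + s * p)"
            using False d by (simp add: K_def d_def[symmetric] powr_divide)
          also have "\<dots> \<le> (2 powr - real n) powr p * (2 powr (real n + 1) * k) powr (N + s * p)"
            using n d k N sp p by (intro mult_mono powr_mono2) auto
          also have "\<dots> = b n"
            by (simp add: b_def powr_powr)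
          also have "ennreal (b n) \<le> g n y"
          proof -
            have "(2::real) powr - real n < 2 powr (1 - real n)" by simp
            then have "k * d < 2 powr (1 - real n)" using n by linarith
            then show ?thesis
              using k by (simp add: g_def dist indicator_def field_simps)
          qed
          finally show ?thesis by (auto simp: ennreal_leI)
        qed
      qed
      then obtain n where "ennreal (K y) \<le> g n y" ..
      also have "\<dots> \<le> (\<Sum>n. g n y)"
        using sum_le_suminf[of "\<lambda>n. g n y" "{n}"] by simp
      finally show ?thesis .
    qed
    have g_int: "(\<integral>\<^sup>+y. g n y \<partial>lebesgue) = ennreal (k powr (s * p) * (A n + B n))" for n
    proof -
      have "(\<integral>\<^sup>+y. g n y \<partial>lebesgue) = ennreal (a n) * emeasure lebesgue (ball x (2 powr (real n + 1) / k))
          + ennreal (b n) * emeasure lebesgue (ball x (2 powr (1 - real n) / k))"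
        unfolding g_def by (subst nn_integral_add) (auto simp: nn_integral_cmult_indicator
          intro!: borel_measurable_times_ennreal borel_measurable_indicator)
      also have "\<dots> = ennreal (a n * (\<omega> * (2 powr (real n + 1) / k) powr N)
          + b n * (\<omega> * (2 powr (1 - real n) / k) powr N))"
        using k \<omega> by (simp add: emeasure_lborel_ball a_def b_def \<omega>_def[symmetric] N_def[symmetric]
            ennreal_mult'[symmetric] ennreal_plus[symmetric] del: ennreal_plus)
      also have "a n * (\<omega> * (2 powr (real n + 1) / k) powr N) = k powr (s * p) * A n"
        using k by (simp add: a_def A_def powr_divide powr_mult powr_add powr_powr powr_minus
            powr_realpow[symmetric] field_simps)
      also have "b n * (\<omega> * (2 powr (1 - real n) / k) powr N) = k powr (s * p) * B n"
      proof -
        have "2 powr (- (real n * p)) * 2 powr ((real n + 1) * (N + s * p)) * 2 powr ((1 - real n) * N)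
            = 2 powr (2 * N + s * p) * (2 powr - (p - s * p)) ^ n"
          by (simp add: powr_add[symmetric] powr_powr powr_realpow[symmetric] algebra_simps)
        moreover have "k powr (N + s * p) / k powr N = k powr (s * p)"
          using k by (simp add: powr_add)
        ultimately show ?thesis
          using k by (simp add: b_def B_def powr_divide powr_mult powr_powr field_simps)
      qed
      finally show ?thesis by (simp add: distrib_left)
    qed
    have "(\<integral>\<^sup>+y. ennreal (K y) \<partial>lebesgue) \<le> (\<integral>\<^sup>+y. (\<Sum>n. g n y) \<partial>lebesgue)"
      by (intro nn_integral_mono K_le)
    also have "\<dots> = (\<Sum>n. \<integral>\<^sup>+y. g n y \<partial>lebesgue)"
      unfolding g_def by (intro nn_integral_suminf borel_measurable_add borel_measurable_times_ennreal
        borel_measurable_indicator) auto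
    also have "\<dots> = (\<Sum>n. ennreal (k powr (s * p) * (A n + B n)))"
      by (simp only: g_int)
    also have "\<dots> = ennreal (\<Sum>n. k powr (s * p) * (A n + B n))"
      using AB by (intro suminf_ennreal2 summable_mult summ) auto
    also have "(\<Sum>n. k powr (s * p) * (A n + B n)) = C * k powr (s * p)"
      by (simp add: suminf_mult[OF summ] C_def)
    finally show ?thesis
      by (simp add: K_def N_def)
  qed
  ultimately show ?thesis by blast
qed

section \<open>Upper bound for the Gagliardo double integral\<close>

lemma borel_measurable_ident_lebesgue_on: "(\<lambda>x. x) \<in> borel_measurable (lebesgue_on \<Omega>)"
  by (intro measurable_restrict_space1 measurable_completion) simp

lemma borel_measurable_pair_lebesgue_on:
  fixes \<Omega> :: "'a::euclidean_space set"
  shows "fst \<in> borel_measurable (lebesgue_on \<Omega> \<Otimes>\<^sub>M lebesgue_on \<Omega>)"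
    "snd \<in> borel_measurable (lebesgue_on \<Omega> \<Otimes>\<^sub>M lebesgue_on \<Omega>)"
  using measurable_compose[OF measurable_fst borel_measurable_ident_lebesgue_on]
    measurable_compose[OF measurable_snd borel_measurable_ident_lebesgue_on] by auto

lemma nn_integral_lebesgue_on_le:
  "\<Omega> \<in> sets lebesgue \<Longrightarrow> (\<integral>\<^sup>+x. f x \<partial>lebesgue_on \<Omega>) \<le> (\<integral>\<^sup>+x. f x \<partial>lebesgue)"
  by (subst nn_integral_restrict_space) (auto intro!: nn_integral_mono simp: indicator_def)

lemma emeasure_lebesgue_on_eq:
  assumes "\<Omega> \<in> sets lebesgue" "S \<in> lmeasurable" "S \<subseteq> \<Omega>"
  shows "emeasure (lebesgue_on \<Omega>) S = ennreal (measure lebesgue S)"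
  using assms by (simp add: emeasure_restrict_space emeasure_eq_measure2)

text \<open>Size and Lipschitz bound together give \<open>2 * A * min 1 (k * norm (x - y))\<close>
  for the difference, and the integrand vanishes unless \<open>x\<close> or \<open>y\<close> lies in
  \<open>S\<close>. Integrating the kernel over the other variable leaves the measure of
  \<open>S\<close>. The constant precedes all data, so it serves a whole sequence.\<close>

lemma gagliardo_upper:
  fixes s p :: real
  assumes s: "0 < s" "s < 1" and p: "1 \<le> p"
  shows "\<exists>C\<ge>0. \<forall>(\<Omega>::'a::euclidean_space set) S u A k. \<Omega> \<in> lmeasurable \<longrightarrow> S \<in> lmeasurable \<longrightarrow> S \<subseteq> \<Omega> \<longrightarrow>
      0 \<le> A \<longrightarrow> 0 < k \<longrightarrow> (\<forall>x. \<bar>u x\<bar> \<le> A) \<longrightarrow> (\<forall>x y. \<bar>u x - u y\<bar> \<le> A * k * norm (x - y)) \<longrightarrow>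
      (\<forall>x\<in>\<Omega> - S. u x = 0) \<longrightarrow>
      gagliardo \<Omega> s p u \<le> ennreal (C * ((A * k powr s) powr p * measure lebesgue S))"
proof -
  obtain C where C: "0 \<le> C" "\<And>k (x::'a). 0 < k \<Longrightarrow>
      (\<integral>\<^sup>+y. ennreal (min 1 (k * norm (x - y)) powr p / norm (x - y) powr (real DIM('a) + s * p)) \<partial>lebesgue)
        \<le> ennreal (C * k powr (s * p))"
    using nn_integral_gagliardo_kernel[OF s p, where 'a = 'a] by blast
  show ?thesis
  proof (intro exI[of _ "2 * 2 powr p * C"] conjI allI impI)
    show "0 \<le> 2 * 2 powr p * C" using C by simp
    fix \<Omega> S :: "'a set" and u A k
    assume \<Omega>: "\<Omega> \<in> lmeasurable" and S: "S \<in> lmeasurable" "S \<subseteq> \<Omega>" and A: "0 \<le> A" and k: "0 < k"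
      and uA: "\<forall>x. \<bar>u x\<bar> \<le> A" and lip: "\<forall>x y. \<bar>u x - u y\<bar> \<le> A * k * norm (x - y)"
      and out: "\<forall>x\<in>\<Omega> - S. u x = 0"
    define M where "M = lebesgue_on \<Omega>"
    interpret M: finite_measure M
      unfolding M_def by (rule finite_measure_lebesgue_on[OF \<Omega>])
    interpret pair_sigma_finite M M ..
    have \<Omega>': "\<Omega> \<in> sets lebesgue" using \<Omega> by auto
    have SM: "S \<in> sets M"
      using S \<Omega>' by (auto simp: M_def sets_restrict_space_iff)
    define K where "K x y = ennreal ((2 * A) powr p) * ennreal (min 1 (k * norm (x - y)) powr p
        / norm (x - y) powr (real DIM('a) + s * p))" for x y :: 'a
    have fs: "fst \<in> borel_measurable (M \<Otimes>\<^sub>M M)" "snd \<in> borel_measurable (M \<Otimes>\<^sub>M M)"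
      unfolding M_def by (rule borel_measurable_pair_lebesgue_on)+
    have [measurable]: "(\<lambda>z. K (fst z) (snd z)) \<in> borel_measurable (M \<Otimes>\<^sub>M M)"
      unfolding K_def using fs by measurable
    have ind[measurable]: "(\<lambda>z. indicator S (fst z) :: ennreal) \<in> borel_measurable (M \<Otimes>\<^sub>M M)"
      "(\<lambda>z. indicator S (snd z) :: ennreal) \<in> borel_measurable (M \<Otimes>\<^sub>M M)"
      using SM by measurable
    have K_int: "(\<integral>\<^sup>+y. K x y \<partial>M) \<le> ennreal ((2 * A) powr p * (C * k powr (s * p)))" for x
    proof -
      have "(\<integral>\<^sup>+y. K x y \<partial>M) \<le> (\<integral>\<^sup>+y. K x y \<partial>lebesgue)"
        unfolding M_def by (rule nn_integral_lebesgue_on_le[OF \<Omega>'])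
      also have "\<dots> = ennreal ((2 * A) powr p) * (\<integral>\<^sup>+y. ennreal (min 1 (k * norm (x - y)) powr p
          / norm (x - y) powr (real DIM('a) + s * p)) \<partial>lebesgue)"
        unfolding K_def by (rule nn_integral_cmult) (intro measurable_completion; measurable)
      also have "\<dots> \<le> ennreal ((2 * A) powr p) * ennreal (C * k powr (s * p))"
        by (intro mult_left_mono C k) auto
      finally show ?thesis using C(1) by (simp add: ennreal_mult')
    qed
    have sym: "K x y = K y x" for x y by (simp add: K_def norm_minus_commute)
    have "gagliardo \<Omega> s p u \<le> (\<integral>\<^sup>+z. K (fst z) (snd z) * indicator S (fst z)
        + K (fst z) (snd z) * indicator S (snd z) \<partial>(M \<Otimes>\<^sub>M M))"
      unfolding gagliardo_def M_def[symmetric]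
    proof (intro nn_integral_mono, clarify)
      fix x y assume "(x, y) \<in> space (M \<Otimes>\<^sub>M M)"
      then have xy: "x \<in> \<Omega>" "y \<in> \<Omega>" by (auto simp: space_pair_measure M_def)
      show "ennreal (\<bar>u x - u y\<bar> powr p / norm (x - y) powr (real DIM('a) + s * p))
          \<le> K (fst (x, y)) (snd (x, y)) * indicator S (fst (x, y))
            + K (fst (x, y)) (snd (x, y)) * indicator S (snd (x, y))"
      proof (cases "x \<in> S \<or> y \<in> S")
        case True
        have "\<bar>u x - u y\<bar> \<le> 2 * A" using uA[rule_format, of x] uA[rule_format, of y] by linarith
        moreover have "A * k * norm (x - y) \<le> 2 * A * (k * norm (x - y))"
          using A k by (simp add: mult_nonneg_nonneg)
        ultimately have "\<bar>u x - u y\<bar> \<le> 2 * A * min 1 (k * norm (x - y))"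
          using lip[rule_format, of x y] by (auto simp: min_def)
        then have "\<bar>u x - u y\<bar> powr p \<le> (2 * A * min 1 (k * norm (x - y))) powr p"
          using p by (intro powr_mono2) auto
        also have "\<dots> = (2 * A) powr p * min 1 (k * norm (x - y)) powr p"
          by (rule powr_mult)
        finally have "ennreal (\<bar>u x - u y\<bar> powr p / norm (x - y) powr (real DIM('a) + s * p)) \<le> K x y"
          unfolding K_def
          by (subst ennreal_mult'[symmetric]) (auto intro!: ennreal_leI divide_right_mono simp: field_simps)
        also have "\<dots> \<le> K x y * indicator S x + K x y * indicator S y"
          using True by (auto simp: indicator_def)
        finally show ?thesis by simp
      next
        case False
        then have "u x = 0" "u y = 0" using out xy by auto
        then show ?thesis by simp
      qed
    qed
    also have "\<dots> = (\<integral>\<^sup>+z. K (fst z) (snd z) * indicator S (fst z) \<partial>(M \<Otimes>\<^sub>M M))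
        + (\<integral>\<^sup>+z. K (fst z) (snd z) * indicator S (snd z) \<partial>(M \<Otimes>\<^sub>M M))"
      by (rule nn_integral_add) measurable
    also have "(\<integral>\<^sup>+z. K (fst z) (snd z) * indicator S (fst z) \<partial>(M \<Otimes>\<^sub>M M))
        = (\<integral>\<^sup>+x. \<integral>\<^sup>+y. K x y * indicator S x \<partial>M \<partial>M)"
      by (rule trans[OF M.nn_integral_fst[symmetric]]) auto
    \<comment> \<open>Integrating in the opposite order and using the symmetry of \<open>K\<close>
      turns the half with \<open>y\<close> in \<open>S\<close> into the half with \<open>x\<close>
      in \<open>S\<close>.\<close>
    also have "(\<integral>\<^sup>+z. K (fst z) (snd z) * indicator S (snd z) \<partial>(M \<Otimes>\<^sub>M M))
        = (\<integral>\<^sup>+x. \<integral>\<^sup>+y. K x y * indicator S x \<partial>M \<partial>M)"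
      by (rule trans[OF nn_integral_snd[symmetric]]) (auto simp: sym)
    also have "(\<integral>\<^sup>+x. \<integral>\<^sup>+y. K x y * indicator S x \<partial>M \<partial>M)
        \<le> (\<integral>\<^sup>+x. ennreal ((2 * A) powr p * (C * k powr (s * p))) * indicator S x \<partial>M)"
      by (intro nn_integral_mono) (auto simp: indicator_def K_int)
    also have "\<dots> = ennreal ((2 * A) powr p * (C * k powr (s * p))) * ennreal (measure lebesgue S)"
      using SM emeasure_lebesgue_on_eq[OF \<Omega>' S] by (simp add: nn_integral_cmult_indicator M_def)
    also have "\<dots> = ennreal ((2 * A) powr p * (C * k powr (s * p)) * measure lebesgue S)"
      by (simp add: ennreal_mult'')
    finally have "gagliardo \<Omega> s p u \<le> ennreal ((2 * A) powr p * (C * k powr (s * p)) * measure lebesgue S)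
        + ennreal ((2 * A) powr p * (C * k powr (s * p)) * measure lebesgue S)"
      by (simp add: add_mono)
    also have "\<dots> = ennreal (2 * 2 powr p * C * ((A * k powr s) powr p * measure lebesgue S))"
      using A C(1) k by (subst ennreal_plus[symmetric]) (auto simp: powr_mult powr_powr algebra_simps)
    finally show "gagliardo \<Omega> s p u \<le> ennreal (2 * 2 powr p * C * ((A * k powr s) powr p * measure lebesgue S))" .
  qed
qed

subsection \<open>Bounds for Sobolev norms\<close>

text \<open>Both Gamma arguments are positive: \<open>p + N - 2 \<ge> 0\<close> since
  \<open>p\<close> and \<open>N\<close> are at least 1, \<open>p * s > 0\<close>, and
  \<open>1 - s > 0\<close>.\<close>

lemma sobolev_const_pos:
  assumes "0 < s" "s < 1" "1 \<le> p" "1 \<le> N"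
  shows "0 < sobolev_const N s p"
proof -
  have "0 < p * s" "1 \<le> real N" using assms by simp_all
  then have "0 < (p * s + p + real N - 2) / 2" using assms(3) by (intro divide_pos_pos) linarith+
  then show ?thesis
    using assms by (auto simp: sobolev_const_def intro!: divide_pos_pos mult_pos_pos Gamma_real_pos)
qed

lemma ennreal_pow_mono: "0 < p \<Longrightarrow> x \<le> y \<Longrightarrow> ennreal_pow x p \<le> ennreal_pow y p"
  by (auto simp: ennreal_pow_def less_top[symmetric] top_unique
      intro!: ennreal_leI powr_mono2 enn2real_mono)

lemma nn_integral_powr_le:
  fixes f :: "'a::euclidean_space \<Rightarrow> 'b::real_normed_vector"
  assumes \<Omega>: "\<Omega> \<in> sets lebesgue" and S: "S \<in> lmeasurable" "S \<subseteq> \<Omega>" and p: "0 < p"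
    and bound: "\<And>x. norm (f x) \<le> A" and out: "\<And>x. x \<in> \<Omega> - S \<Longrightarrow> f x = 0"
  shows "(\<integral>\<^sup>+x. ennreal (norm (f x) powr p) \<partial>lebesgue_on \<Omega>) \<le> ennreal (A powr p * measure lebesgue S)"
proof -
  have "(\<integral>\<^sup>+x. ennreal (norm (f x) powr p) \<partial>lebesgue_on \<Omega>)
      \<le> (\<integral>\<^sup>+x. ennreal (A powr p) * indicator S x \<partial>lebesgue_on \<Omega>)"
    using out bound p
    by (intro nn_integral_mono) (auto simp: indicator_def intro!: ennreal_leI powr_mono2)
  also have "\<dots> = ennreal (A powr p) * emeasure (lebesgue_on \<Omega>) S"
    using S \<Omega> by (intro nn_integral_cmult_indicator) (auto simp: sets_restrict_space_iff)
  also have "\<dots> = ennreal (A powr p * measure lebesgue S)"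
    by (simp add: emeasure_lebesgue_on_eq[OF \<Omega> S] ennreal_mult')
  finally show ?thesis .
qed

lemma continuous_imp_measurable_lebesgue_on:
  fixes u :: "'a::euclidean_space \<Rightarrow> 'b::euclidean_space"
  shows "continuous_on UNIV u \<Longrightarrow> u \<in> borel_measurable (lebesgue_on \<Omega>)"
  using measurable_compose[OF borel_measurable_ident_lebesgue_on borel_measurable_continuous_onI] by auto

text \<open>A function of size \<open>A\<close> varying at length scale \<open>1 / k\<close> on the
  carrier \<open>S\<close>. Bumps use a shrinking ball for \<open>S\<close>, oscillations use all of
  \<Omega>.\<close>

definition C1_profile ::
  "'a::euclidean_space set \<Rightarrow> 'a set \<Rightarrow> ('a \<Rightarrow> real) \<Rightarrow> ('a \<Rightarrow> 'a) \<Rightarrow> real \<Rightarrow> real \<Rightarrow> bool" where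
  "C1_profile \<Omega> S u G A k \<longleftrightarrow> \<Omega> \<in> lmeasurable \<and> S \<in> lmeasurable \<and> S \<subseteq> \<Omega> \<and> 0 \<le> A \<and> 1 \<le> k \<and>
     C1_gradient u G \<and> (\<forall>x. \<bar>u x\<bar> \<le> A) \<and> (\<forall>x. norm (G x) \<le> A * k) \<and>
     (\<forall>x\<in>\<Omega> - S. u x = 0 \<and> G x = 0)"

text \<open>For \<open>s = 1\<close> the classical gradient is one competitor in the infimum; for
  \<open>s < 1\<close> the bound is \<open>gagliardo_upper\<close>. The extra 1 in the final
  constant pays for the \<open>L^p\<close> part.\<close>

lemma sobolev_norm_C1_profile_le:
  fixes s p :: real
  assumes s: "0 < s" "s \<le> 1" and p: "1 \<le> p"
  shows "\<exists>C\<ge>0. \<forall>(\<Omega>::'a::euclidean_space set) S u G A k. C1_profile \<Omega> S u G A k \<longrightarrow>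
      u \<in> sobolev_space \<Omega> s (ereal p) \<and>
      sobolev_norm \<Omega> s (ereal p) u \<le> ennreal_root p (ennreal (C * ((A * k powr s) powr p * measure lebesgue S)))"
proof -
  have "\<exists>C\<ge>0. \<forall>(\<Omega>::'a set) S u G A k. C1_profile \<Omega> S u G A k \<longrightarrow>
      ennreal_pow (sobolev_seminorm \<Omega> s p u) p \<le> ennreal (C * ((A * k powr s) powr p * measure lebesgue S))"
  proof (cases "s = 1")
    case True
    have *: "ennreal_pow (sobolev_seminorm \<Omega> s p u) p \<le> ennreal (1 * ((A * k powr s) powr p * measure lebesgue S))"
      if prof: "C1_profile \<Omega> S u G A k" for \<Omega> S :: "'a set" and u G A k
    proof -
      have \<Omega>: "\<Omega> \<in> lmeasurable" and S: "S \<in> lmeasurable" "S \<subseteq> \<Omega>" and k: "1 \<le> k"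
        and u: "C1_gradient u G" and G: "\<forall>x. norm (G x) \<le> A * k" "\<forall>x\<in>\<Omega> - S. u x = 0 \<and> G x = 0"
        using prof by (auto simp: C1_profile_def)
      have \<Omega>': "\<Omega> \<in> sets lebesgue" using \<Omega> by auto
      have "sobolev_seminorm \<Omega> s p u \<le> Lp_norm \<Omega> (ereal p) G"
        using True has_weak_gradient_C1[OF u \<Omega>'] by (auto simp: sobolev_seminorm_def intro: INF_lower)
      then have "ennreal_pow (sobolev_seminorm \<Omega> s p u) p \<le> ennreal_pow (Lp_norm \<Omega> (ereal p) G) p"
        using p by (intro ennreal_pow_mono) auto
      also have "\<dots> = (\<integral>\<^sup>+x. ennreal (norm (G x) powr p) \<partial>lebesgue_on \<Omega>)"
        using p by (simp add: Lp_norm_real ennreal_pow_root)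
      also have "\<dots> \<le> ennreal ((A * k) powr p * measure lebesgue S)"
        using p G by (intro nn_integral_powr_le \<Omega>' S) auto
      finally show ?thesis using True k by simp
    qed
    show ?thesis
      by (intro exI[of _ 1] conjI allI impI) (simp, (rule *; assumption))
  next
    case False
    then have s': "s < 1" using s by simp
    obtain C where C: "0 \<le> C"
      "\<forall>(\<Omega>::'a set) S u A k. \<Omega> \<in> lmeasurable \<longrightarrow> S \<in> lmeasurable \<longrightarrow> S \<subseteq> \<Omega> \<longrightarrow>
      0 \<le> A \<longrightarrow> 0 < k \<longrightarrow> (\<forall>x. \<bar>u x\<bar> \<le> A) \<longrightarrow> (\<forall>x y. \<bar>u x - u y\<bar> \<le> A * k * norm (x - y)) \<longrightarrow>
      (\<forall>x\<in>\<Omega> - S. u x = 0) \<longrightarrow>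
      gagliardo \<Omega> s p u \<le> ennreal (C * ((A * k powr s) powr p * measure lebesgue S))"
      using gagliardo_upper[OF s(1) s' p, where 'a = 'a] by (elim exE conjE) (rule that)
    define c where "c = sobolev_const DIM('a) s p"
    have c: "0 < c" unfolding c_def by (rule sobolev_const_pos) (use s s' p in \<open>auto simp: Suc_le_eq\<close>)
    have *: "ennreal_pow (sobolev_seminorm \<Omega> s p u) p \<le> ennreal (c * C * ((A * k powr s) powr p * measure lebesgue S))"
      if prof: "C1_profile \<Omega> S u G A k" for \<Omega> S :: "'a set" and u G A k
    proof -
      have "ennreal_pow (sobolev_seminorm \<Omega> s p u) p = ennreal c * gagliardo \<Omega> s p u"
        using s s' p by (simp add: sobolev_seminorm_def gagliardo_def c_def ennreal_pow_root)
      also have "\<dots> \<le> ennreal c * ennreal (C * ((A * k powr s) powr p * measure lebesgue S))"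
        using prof C1_gradient_lipschitz[of u G] unfolding C1_profile_def by (intro mult_left_mono C(2)[rule_format]) auto
      finally show ?thesis using c by (simp add: ennreal_mult'[symmetric] mult.assoc)
    qed
    show ?thesis
      by (intro exI[of _ "c * C"] conjI allI impI) (use c C(1) in simp, (rule *; assumption))
  qed
  then obtain C where C: "0 \<le> C" "\<forall>(\<Omega>::'a set) S u G A k. C1_profile \<Omega> S u G A k \<longrightarrow>
      ennreal_pow (sobolev_seminorm \<Omega> s p u) p \<le> ennreal (C * ((A * k powr s) powr p * measure lebesgue S))"
    by (elim exE conjE) (rule that)
  have *: "u \<in> sobolev_space \<Omega> s (ereal p) \<and> sobolev_norm \<Omega> s (ereal p) u
      \<le> ennreal_root p (ennreal ((C + 1) * ((A * k powr s) powr p * measure lebesgue S)))"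
    if prof: "C1_profile \<Omega> S u G A k" for \<Omega> S :: "'a set" and u G A k
  proof -
    have \<Omega>: "\<Omega> \<in> lmeasurable" and S: "S \<in> lmeasurable" "S \<subseteq> \<Omega>" and A: "0 \<le> A" and k: "1 \<le> k"
      and u: "C1_gradient u G" "\<forall>x. \<bar>u x\<bar> \<le> A" and G: "\<forall>x\<in>\<Omega> - S. u x = 0 \<and> G x = 0"
      using prof by (auto simp: C1_profile_def)
    define D where "D = (A * k powr s) powr p * measure lebesgue S"
    have semi: "ennreal_pow (sobolev_seminorm \<Omega> s p u) p \<le> ennreal (C * D)"
      unfolding D_def by (rule C(2)[rule_format, OF prof])
    have "(\<integral>\<^sup>+x. ennreal (norm (u x) powr p) \<partial>lebesgue_on \<Omega>) \<le> ennreal (A powr p * measure lebesgue S)"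
      using p u G \<Omega> by (intro nn_integral_powr_le S) auto
    also have "\<dots> \<le> ennreal D"
    proof -
      \<comment> \<open>Since \<open>k \<ge> 1\<close>, the \<open>L^p\<close> part is dominated by
        the scale of the seminorm.\<close>
      have "A * 1 \<le> A * k powr s"
        using A k s by (intro mult_left_mono) (auto simp: ge_one_powr_ge_zero)
      then show ?thesis
        using A p unfolding D_def by (intro ennreal_leI mult_right_mono powr_mono2) auto
    qed
    finally have Lp: "ennreal_pow (Lp_norm \<Omega> (ereal p) u) p \<le> ennreal D"
      using p by (simp add: Lp_norm_real ennreal_pow_root)
    have fin: "x < \<infinity>" if "ennreal_pow x p \<le> ennreal E" for x E
      using that by (auto simp: ennreal_pow_def less_top top_unique split: if_splits)
    have "u \<in> borel_measurable (lebesgue_on \<Omega>)"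
      by (intro continuous_imp_measurable_lebesgue_on C1_gradient_continuous[OF u(1)])
    then have "u \<in> sobolev_space \<Omega> s (ereal p)"
      using fin[OF semi] fin[OF Lp] by (simp add: sobolev_space_def Lp_space_def)
    moreover have "sobolev_norm \<Omega> s (ereal p) u \<le> ennreal_root p (ennreal ((C + 1) * D))"
    proof -
      have "sobolev_norm \<Omega> s (ereal p) u \<le> ennreal_root p (ennreal (C * D) + ennreal D)"
        using s p semi Lp by (auto simp: sobolev_norm_def intro!: ennreal_root_mono add_mono)
      also have "ennreal (C * D) + ennreal D = ennreal ((C + 1) * D)"
        using C(1) by (subst ennreal_plus[symmetric]) (auto simp: D_def algebra_simps)
      finally show ?thesis .
    qed
    ultimately show ?thesis by (simp add: D_def)
  qed
  show ?thesis
    by (rule exI[of _ "C + 1"], rule conjI, use C(1) in simp, intro allI impI, (rule *; assumption))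
qed

section \<open>Lower bounds from separated pairs of points\<close>

text \<open>The offset \<open>3 / k\<close> keeps the two points at distance between \<open>2 / k\<close> and \<open>4 / k\<close>: a bump of radius
  \<open>1 / k\<close> vanishes at the second one, and the phase \<open>k (y - x) \<bullet> e\<close> of an oscillation stays in \<open>[2, 4]\<close>,
  where the cosine is negative.\<close>

definition separated ::
  "'a::euclidean_space set \<Rightarrow> ('a \<Rightarrow> real) \<Rightarrow> ('a \<Rightarrow> real) \<Rightarrow> 'a \<Rightarrow> real \<Rightarrow> 'a \<Rightarrow> real \<Rightarrow> real \<Rightarrow> bool" where
  "separated \<Omega> u w z r e k A \<longleftrightarrow>
     0 < r \<and> 0 < k \<and> norm e = 1 \<and> 0 \<le> A \<and> ball z r \<subseteq> \<Omega> \<and>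
     (\<forall>x\<in>ball z r. ball (x + (3 / k) *\<^sub>R e) (1 / k) \<subseteq> \<Omega> \<and>
        (\<forall>y\<in>ball (x + (3 / k) *\<^sub>R e) (1 / k). A \<le> \<bar>u x - u y\<bar> + \<bar>w x - w y\<bar>))"

lemma separated_dist:
  assumes "separated \<Omega> u w z r e k A" "y \<in> ball (x + (3 / k) *\<^sub>R e) (1 / k)"
  shows "0 < norm (x - y)" "norm (x - y) \<le> 4 / k"
proof -
  have k: "0 < k" and e: "norm ((3 / k) *\<^sub>R e) = 3 / k"
    using assms by (auto simp: separated_def)
  have "norm (x - y + (3 / k) *\<^sub>R e) < 1 / k"
    using assms(2) by (simp add: dist_norm algebra_simps)
  then have "norm (x - y) < 3 / k + 1 / k" "3 / k - 1 / k < norm (x - y)"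
    using norm_triangle_ineq4[of "x - y + (3 / k) *\<^sub>R e" "(3 / k) *\<^sub>R e"]
      norm_triangle_ineq4[of "x - y + (3 / k) *\<^sub>R e" "x - y"] e by auto
  moreover have "0 < 3 / k - 1 / k" "3 / k + 1 / k = 4 / k"
    using k by (auto simp: field_simps)
  ultimately show "0 < norm (x - y)" "norm (x - y) \<le> 4 / k" by linarith+
qed

text \<open>For separated pairs the two integrands together are at least
  \<open>(A / 2) powr q * (k / 4) powr (N + s * q)\<close>. The admissible \<open>y\<close> have
  volume proportional to \<open>k powr (- N)\<close>, which leaves \<open>k powr (s * q)\<close>;
  the admissible \<open>x\<close> contribute \<open>r powr N\<close>.\<close>

lemma gagliardo_pair_lower:
  fixes \<Omega> :: "'a::euclidean_space set"
  assumes \<Omega>: "\<Omega> \<in> lmeasurable" and s: "0 < s" and q: "0 < q"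
    and u: "continuous_on UNIV u" and w: "continuous_on UNIV w"
    and sep: "separated \<Omega> u w z r e k A"
  shows "ennreal ((measure lborel (ball (0::'a) 1))\<^sup>2 * (1 / 2) powr q * (1 / 4) powr (real DIM('a) + s * q) *
          ((A * k powr s) powr q * r powr real DIM('a)))
      \<le> gagliardo \<Omega> s q u + gagliardo \<Omega> s q w"
proof -
  define N where "N = real DIM('a)"
  define \<omega> where "\<omega> = measure lborel (ball (0::'a) 1)"
  define M where "M = lebesgue_on \<Omega>"
  interpret M: finite_measure M
    unfolding M_def by (rule finite_measure_lebesgue_on[OF \<Omega>])
  have \<Omega>': "\<Omega> \<in> sets lebesgue" using \<Omega> by auto
  have r: "0 < r" and k: "0 < k" and A: "0 \<le> A" and zr: "ball z r \<subseteq> \<Omega>"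
    using sep by (auto simp: separated_def)
  have \<omega>: "0 \<le> \<omega>" by (simp add: \<omega>_def)
  have ball_M: "ball c t \<in> sets M" "emeasure M (ball c t) = ennreal (\<omega> * t powr N)"
    if "ball c t \<subseteq> \<Omega>" "0 < t" for c t
    using that \<Omega>' emeasure_lborel_ball[of t c]
    by (auto simp: M_def sets_restrict_space_iff emeasure_restrict_space \<omega>_def N_def)
  define f where "f v x y = ennreal (\<bar>v x - v y\<bar> powr q / norm (x - y) powr (N + s * q))"
    for v :: "'a \<Rightarrow> real" and x y
  have f_meas: "(\<lambda>p. f v (fst p) (snd p)) \<in> borel_measurable (M \<Otimes>\<^sub>M M)" if "continuous_on UNIV v" for v
  proof -
    have [measurable]: "fst \<in> borel_measurable (M \<Otimes>\<^sub>M M)" "snd \<in> borel_measurable (M \<Otimes>\<^sub>M M)"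
      unfolding M_def by (rule borel_measurable_pair_lebesgue_on)+
    have [measurable]: "v \<in> borel_measurable borel"
      using that by (rule borel_measurable_continuous_onI)
    show ?thesis unfolding f_def by measurable
  qed
  note f_meas[OF u, measurable] f_meas[OF w, measurable]
  define c where "c = (A / 2) powr q * (k / 4) powr (N + s * q)"
  have f_lower: "ennreal c \<le> f u x y + f w x y"
    if x: "x \<in> ball z r" and y: "y \<in> ball (x + (3 / k) *\<^sub>R e) (1 / k)" for x y
  proof -
    have d: "0 < norm (x - y)" "norm (x - y) \<le> 4 / k"
      using separated_dist[OF sep y] by auto
    have *: "ennreal c \<le> f v x y" if "A / 2 \<le> \<bar>v x - v y\<bar>" for v
    proof -
      have "1 / (4 / k) \<le> 1 / norm (x - y)"
        using d k by (intro divide_left_mono) auto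
      then have "(k / 4) powr (N + s * q) \<le> (1 / norm (x - y)) powr (N + s * q)"
        using k s q by (intro powr_mono2) (auto simp: N_def)
      moreover have "(A / 2) powr q \<le> \<bar>v x - v y\<bar> powr q"
        using that A q by (intro powr_mono2) auto
      ultimately have "c \<le> \<bar>v x - v y\<bar> powr q * (1 / norm (x - y)) powr (N + s * q)"
        unfolding c_def by (intro mult_mono) auto
      then show ?thesis
        unfolding f_def by (intro ennreal_leI) (simp add: powr_divide)
    qed
    \<comment> \<open>Which of the two functions varies by \<open>A / 2\<close> may depend on the
      pair, hence the bound is for the sum of the integrands.\<close>
    have "A \<le> \<bar>u x - u y\<bar> + \<bar>w x - w y\<bar>"
      using sep x y by (auto simp: separated_def)
    then have "A / 2 \<le> \<bar>u x - u y\<bar> \<or> A / 2 \<le> \<bar>w x - w y\<bar>" by linarith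
    then show ?thesis
      using * add_increasing add_increasing2 zero_le by metis
  qed
  have inner: "ennreal (c * (\<omega> * (1 / k) powr N)) * indicator (ball z r) x
      \<le> (\<integral>\<^sup>+y. f u x y + f w x y \<partial>M)" for x
  proof (cases "x \<in> ball z r")
    case True
    let ?B = "ball (x + (3 / k) *\<^sub>R e) (1 / k)"
    have B: "?B \<subseteq> \<Omega>" using sep True by (auto simp: separated_def)
    have "ennreal (c * (\<omega> * (1 / k) powr N)) = ennreal c * emeasure M ?B"
      using k \<omega> ball_M(2)[OF B] by (simp add: ennreal_mult'[symmetric] c_def)
    also have "\<dots> = (\<integral>\<^sup>+y. ennreal c * indicator ?B y \<partial>M)"
      using ball_M(1)[OF B] k by (simp add: nn_integral_cmult_indicator)
    also have "\<dots> \<le> (\<integral>\<^sup>+y. f u x y + f w x y \<partial>M)"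
      using f_lower[OF True] by (intro nn_integral_mono) (auto simp: indicator_def)
    finally show ?thesis using True by simp
  qed auto
  have "ennreal (\<omega>\<^sup>2 * (1 / 2) powr q * (1 / 4) powr (N + s * q) * ((A * k powr s) powr q * r powr N))
      = ennreal (c * (\<omega> * (1 / k) powr N) * (\<omega> * r powr N))"
  proof (rule arg_cong[where f = ennreal])
    have *: "k powr (s * q) = k powr (N + s * q) / k powr N"
      using k by (simp add: powr_add)
    show "\<omega>\<^sup>2 * (1 / 2) powr q * (1 / 4) powr (N + s * q) * ((A * k powr s) powr q * r powr N)
        = c * (\<omega> * (1 / k) powr N) * (\<omega> * r powr N)"
      by (simp add: c_def powr_divide powr_mult powr_powr power2_eq_square *)
  qed
  also have "\<dots> = ennreal (c * (\<omega> * (1 / k) powr N)) * emeasure M (ball z r)"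
    using ball_M(2)[OF zr r] \<omega> r by (simp add: ennreal_mult'' del: mult_eq_0_iff)
  also have "\<dots> = (\<integral>\<^sup>+x. ennreal (c * (\<omega> * (1 / k) powr N)) * indicator (ball z r) x \<partial>M)"
    using ball_M(1)[OF zr r] by (simp add: nn_integral_cmult_indicator)
  also have "\<dots> \<le> (\<integral>\<^sup>+x. \<integral>\<^sup>+y. f u x y + f w x y \<partial>M \<partial>M)"
    by (intro nn_integral_mono inner)
  also have "\<dots> = (\<integral>\<^sup>+p. f u (fst p) (snd p) + f w (fst p) (snd p) \<partial>(M \<Otimes>\<^sub>M M))"
    by (rule trans[OF _ M.nn_integral_fst]) auto
  also have "\<dots> = gagliardo \<Omega> s q u + gagliardo \<Omega> s q w"
    by (subst nn_integral_add, measurable)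
      (simp add: gagliardo_def f_def M_def[symmetric] N_def[symmetric] case_prod_beta')
  finally show ?thesis by (simp add: \<omega>_def N_def)
qed

text \<open>A ball of positive radius is not negligible, so it cannot lie inside the exceptional
  set.\<close>

lemma AE_lebesgue_on_obtain:
  assumes "\<Omega> \<in> sets lebesgue" "AE x in lebesgue_on \<Omega>. P x" "ball c t \<subseteq> \<Omega>" "0 < t"
  obtains x where "x \<in> ball c t" "P x"
proof -
  have "AE x in lebesgue. x \<in> \<Omega> \<longrightarrow> P x"
    using assms by (simp add: AE_restrict_space_iff)
  then obtain N where N: "\<And>x. x \<in> space lebesgue - N \<Longrightarrow> x \<in> \<Omega> \<longrightarrow> P x" "N \<in> null_sets lebesgue"
    using AE_E3 by blast
  then have "negligible N" by (simp add: negligible_iff_null_sets)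
  moreover have "\<not> negligible (ball c t)"
    using assms(4) open_not_negligible[of "ball c t"] by auto
  ultimately obtain x where "x \<in> ball c t" "x \<notin> N"
    using negligible_subset by blast
  then show thesis using N(1)[of x] assms(3) that by auto
qed

text \<open>If both infima were below the bound, two representatives \<open>f\<close> and
  \<open>g\<close> would be too. They are evaluated at points where they agree with \<open>u\<close>
  and \<open>w\<close>: \<open>x\<close> first, then \<open>y\<close> in the ball that depends on
  \<open>x\<close>.\<close>

lemma holder_seminorm_pair_lower:
  assumes \<Omega>: "\<Omega> \<in> sets lebesgue" and s: "0 < s"
    and sep: "separated \<Omega> u w z r e k A"
  shows "ennreal (A / 2 * (k / 4) powr s) \<le> holder_seminorm \<Omega> s u \<or>
    ennreal (A / 2 * (k / 4) powr s) \<le> holder_seminorm \<Omega> s w"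
proof (rule ccontr)
  define c where "c = A / 2 * (k / 4) powr s"
  assume "\<not> ?thesis"
  then have "holder_seminorm \<Omega> s u < ennreal c" "holder_seminorm \<Omega> s w < ennreal c"
    by (auto simp: c_def)
  then obtain f g where f: "AE x in lebesgue_on \<Omega>. f x = u x" and g: "AE x in lebesgue_on \<Omega>. g x = w x"
    and lt: "(SUP (x, y)\<in>{(x, y). x \<in> \<Omega> \<and> y \<in> \<Omega> \<and> x \<noteq> y}. ennreal (\<bar>f x - f y\<bar> / norm (x - y) powr s)) < ennreal c"
      "(SUP (x, y)\<in>{(x, y). x \<in> \<Omega> \<and> y \<in> \<Omega> \<and> x \<noteq> y}. ennreal (\<bar>g x - g y\<bar> / norm (x - y) powr s)) < ennreal c"
    unfolding holder_seminorm_def INF_less_iff by blast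
  have r: "0 < r" and k: "0 < k" and A: "0 \<le> A" and zr: "ball z r \<subseteq> \<Omega>"
    using sep by (auto simp: separated_def)
  \<comment> \<open>Merging the two conditions provides one pair of points that is good for both
    representatives.\<close>
  have fg: "AE x in lebesgue_on \<Omega>. f x = u x \<and> g x = w x"
    using f g by eventually_elim auto
  obtain x where x: "x \<in> ball z r" "f x = u x \<and> g x = w x"
    using AE_lebesgue_on_obtain[OF \<Omega> fg zr r] .
  have B: "ball (x + (3 / k) *\<^sub>R e) (1 / k) \<subseteq> \<Omega>"
    using sep x by (auto simp: separated_def)
  obtain y where y: "y \<in> ball (x + (3 / k) *\<^sub>R e) (1 / k)" "f y = u y \<and> g y = w y"
    using AE_lebesgue_on_obtain[OF \<Omega> fg B] k by auto
  have d: "0 < norm (x - y)" "norm (x - y) \<le> 4 / k"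
    using separated_dist[OF sep y(1)] by auto
  have xy: "(x, y) \<in> {(x, y). x \<in> \<Omega> \<and> y \<in> \<Omega> \<and> x \<noteq> y}"
    using x y zr B d by auto
  have *: "\<bar>h x - h y\<bar> < A / 2"
    if "(SUP (x, y)\<in>{(x, y). x \<in> \<Omega> \<and> y \<in> \<Omega> \<and> x \<noteq> y}. ennreal (\<bar>h x - h y\<bar> / norm (x - y) powr s)) < ennreal c"
    for h
  proof (rule ccontr)
    assume "\<not> \<bar>h x - h y\<bar> < A / 2"
    moreover have "(k / 4) powr s \<le> (1 / norm (x - y)) powr s"
      using d k s by (intro powr_mono2) (auto simp: field_simps)
    ultimately have "c \<le> \<bar>h x - h y\<bar> * (1 / norm (x - y)) powr s"
      unfolding c_def using A by (intro mult_mono) auto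
    then have "ennreal c \<le> ennreal (\<bar>h x - h y\<bar> / norm (x - y) powr s)"
      by (intro ennreal_leI) (simp add: powr_divide)
    also have "\<dots> \<le> (SUP (x, y)\<in>{(x, y). x \<in> \<Omega> \<and> y \<in> \<Omega> \<and> x \<noteq> y}. ennreal (\<bar>h x - h y\<bar> / norm (x - y) powr s))"
      using SUP_upper[OF xy, of "\<lambda>(x, y). ennreal (\<bar>h x - h y\<bar> / norm (x - y) powr s)"] by simp
    finally show False using that by simp
  qed
  have "A \<le> \<bar>u x - u y\<bar> + \<bar>w x - w y\<bar>"
    using sep x y by (auto simp: separated_def)
  then show False
    using *[OF lt(1)] *[OF lt(2)] x y by auto
qed

lemma sobolev_norm_pair_lower_infinity:
  assumes \<Omega>: "\<Omega> \<in> sets lebesgue" and s: "0 < s"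
    and sep: "separated \<Omega> u w z r e k A" and \<delta>: "\<delta> \<le> A * k powr s"
  shows "ennreal (\<delta> / 2 * (1 / 4) powr s) \<le> sobolev_norm \<Omega> s \<infinity> u \<or>
    ennreal (\<delta> / 2 * (1 / 4) powr s) \<le> sobolev_norm \<Omega> s \<infinity> w"
proof -
  have "\<delta> / 2 * (1 / 4) powr s \<le> A / 2 * (k / 4) powr s"
    using \<delta> by (simp add: powr_divide divide_right_mono)
  then have "ennreal (\<delta> / 2 * (1 / 4) powr s) \<le> ennreal (A / 2 * (k / 4) powr s)"
    by (rule ennreal_leI)
  moreover have "holder_seminorm \<Omega> s v \<le> sobolev_norm \<Omega> s \<infinity> v" for v
    using s by (simp add: sobolev_norm_def holder_norm_def)
  ultimately show ?thesis
    using holder_seminorm_pair_lower[OF \<Omega> s sep] by (meson order_trans)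
qed

text \<open>The passage from a sum to an alternative takes place for the double integrals, one of
  which is at least half of the bound; only then are the constant and the root restored.\<close>

lemma sobolev_norm_pair_lower:
  fixes s q \<delta> :: real
  assumes s: "0 < s" "s < 1" and q: "1 \<le> q" and \<delta>: "0 < \<delta>"
  shows "\<exists>c>0. \<forall>(\<Omega>::'a::euclidean_space set) u w z r e k A. \<Omega> \<in> lmeasurable \<longrightarrow>
    continuous_on UNIV u \<longrightarrow> continuous_on UNIV w \<longrightarrow> separated \<Omega> u w z r e k A \<longrightarrow>
    \<delta> \<le> (A * k powr s) powr q * r powr real DIM('a) \<longrightarrow>
    c \<le> sobolev_norm \<Omega> s (ereal q) u \<or> c \<le> sobolev_norm \<Omega> s (ereal q) w"
proof -
  define m where "m = sobolev_const DIM('a) s q"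
  have m: "0 < m" unfolding m_def by (rule sobolev_const_pos) (use s q in \<open>auto simp: Suc_le_eq\<close>)
  define a where "a = (measure lborel (ball (0::'a) 1))\<^sup>2 * (1 / 2) powr q * (1 / 4) powr (real DIM('a) + s * q)"
  have a: "0 < a" unfolding a_def using content_ball_pos[of 1 "0::'a"] by simp
  have "ennreal_root q (ennreal (m * (a * \<delta> / 2))) \<le> sobolev_norm \<Omega> s (ereal q) u \<or>
      ennreal_root q (ennreal (m * (a * \<delta> / 2))) \<le> sobolev_norm \<Omega> s (ereal q) w"
    if \<Omega>: "\<Omega> \<in> lmeasurable" and u: "continuous_on UNIV u" and w: "continuous_on UNIV w"
      and sep: "separated \<Omega> u w z r e k A" and le: "\<delta> \<le> (A * k powr s) powr q * r powr real DIM('a)"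
    for \<Omega> :: "'a set" and u w z r e k A
  proof -
    have "ennreal (a * \<delta>) \<le> ennreal (a * ((A * k powr s) powr q * r powr real DIM('a)))"
      using le a by (intro ennreal_leI) auto
    also have "\<dots> \<le> gagliardo \<Omega> s q u + gagliardo \<Omega> s q w"
      unfolding a_def using q by (intro gagliardo_pair_lower[OF \<Omega> s(1) _ u w sep]) auto
    finally have sum: "ennreal (a * \<delta>) \<le> gagliardo \<Omega> s q u + gagliardo \<Omega> s q w" .
    have "ennreal (a * \<delta> / 2) \<le> gagliardo \<Omega> s q u \<or> ennreal (a * \<delta> / 2) \<le> gagliardo \<Omega> s q w"
    proof (rule ccontr)
      assume "\<not> ?thesis"
      then have "gagliardo \<Omega> s q u + gagliardo \<Omega> s q w < ennreal (a * \<delta> / 2) + ennreal (a * \<delta> / 2)"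
        by (intro add_strict_mono) auto
      also have "\<dots> = ennreal (a * \<delta>)"
        using a \<delta> by (subst ennreal_plus[symmetric]) auto
      finally show False using sum by simp
    qed
    moreover have "ennreal_root q (ennreal (m * (a * \<delta> / 2))) \<le> sobolev_norm \<Omega> s (ereal q) v"
      if "ennreal (a * \<delta> / 2) \<le> gagliardo \<Omega> s q v" for v
    proof -
      have "ennreal (m * (a * \<delta> / 2)) = ennreal m * ennreal (a * \<delta> / 2)"
        using m by (intro ennreal_mult') simp
      also have "\<dots> \<le> ennreal m * gagliardo \<Omega> s q v"
        by (intro mult_left_mono that) auto
      finally have "ennreal_root q (ennreal (m * (a * \<delta> / 2))) \<le> ennreal_root q (ennreal m * gagliardo \<Omega> s q v)"
        using q by (intro ennreal_root_mono) auto
      also have "\<dots> = sobolev_seminorm \<Omega> s q v"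
        using s by (simp add: sobolev_seminorm_def gagliardo_def m_def)
      also have "\<dots> \<le> sobolev_norm \<Omega> s (ereal q) v"
        using s q by (intro sobolev_seminorm_le_sobolev_norm) auto
      finally show ?thesis .
    qed
    ultimately show ?thesis by blast
  qed
  note * = this
  have "0 < ennreal_root q (ennreal (m * (a * \<delta> / 2)))"
    using m a \<delta> by (simp add: ennreal_root_ennreal)
  then show ?thesis
    by (intro exI[of _ "ennreal_root q (ennreal (m * (a * \<delta> / 2)))"] conjI allI impI) (assumption, (rule *; assumption))
qed

subsection \<open>Smooth bumps and lower bounds for weak gradients\<close>

text \<open>With \<open>y = 1 / t\<close> this is \<open>y ^ m * exp (- y)\<close>, extended by 0:
  the terms that arise on differentiating the flat function \<open>exp (- 1 / t)\<close>
  repeatedly.\<close>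

definition exp_bump :: "nat \<Rightarrow> real \<Rightarrow> real" where
  "exp_bump m t = (if 0 < t then inverse t ^ m / exp (inverse t) else 0)"

lemma exp_bump_nonneg: "0 \<le> exp_bump m t"
  by (simp add: exp_bump_def)

lemma exp_bump_0_le: "exp_bump 0 t \<le> 1"
  by (simp add: exp_bump_def)

lemma exp_bump_2_le: "exp_bump 2 t \<le> 2"
proof (cases "0 < t")
  case True
  define y where "y = inverse t"
  have "0 < y" using True by (simp add: y_def)
  then have "y\<^sup>2 \<le> 2 * exp y"
    using exp_lower_Taylor_quadratic[of y] by simp
  then show ?thesis
    using True by (simp add: exp_bump_def y_def[symmetric] divide_le_eq)
qed (simp add: exp_bump_def)

lemma tendsto_exp_bump_0: "(exp_bump m \<longlongrightarrow> 0) (at 0)"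
proof (rule filterlim_split_at)
  show "(exp_bump m \<longlongrightarrow> 0) (at_left 0)"
  proof (rule tendsto_eventually)
    show "\<forall>\<^sub>F t in at_left 0. exp_bump m t = 0"
      by (simp add: exp_bump_def eventually_at_filter)
  qed
  have "((\<lambda>t. inverse t ^ m / exp (inverse t)) \<longlongrightarrow> 0) (at_right (0::real))"
    by (rule filterlim_compose[OF tendsto_power_div_exp_0 filterlim_inverse_at_top_right])
  then show "(exp_bump m \<longlongrightarrow> 0) (at_right 0)"
  proof (rule Lim_transform_eventually)
    show "\<forall>\<^sub>F t in at_right 0. inverse t ^ m / exp (inverse t) = exp_bump m t"
      by (simp add: exp_bump_def eventually_at_filter)
  qed
qed

text \<open>From \<open>y' = - y\<^sup>2\<close> the power contributes
  \<open>- m * y ^ (m + 1)\<close> and the exponential \<open>y ^ (m + 2)\<close>, so the family is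
  closed under differentiation up to linear combinations.\<close>

lemma DERIV_exp_bump:
  "(exp_bump m has_real_derivative - real m * exp_bump (Suc m) t + exp_bump (m + 2) t) (at t)"
proof -
  consider "0 < t" | "t < 0" | "t = 0" by linarith
  then show ?thesis
  proof cases
    case 1
    define y where "y = inverse t"
    have "((\<lambda>t. inverse t ^ m) has_real_derivative real m * (y ^ (m - Suc 0) * - (y * y))) (at t)"
      using 1 by (auto intro!: derivative_eq_intros simp: y_def)
    also have "real m * (y ^ (m - Suc 0) * - (y * y)) = - real m * y ^ Suc m"
      by (cases m) (auto simp: algebra_simps)
    finally have d1: "((\<lambda>t. inverse t ^ m) has_real_derivative - real m * y ^ Suc m) (at t)" .
    have d2: "((\<lambda>t. exp (- inverse t)) has_real_derivative y * y * exp (- y)) (at t)"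
      using 1 by (auto intro!: derivative_eq_intros simp: y_def)
    have "((\<lambda>t. inverse t ^ m * exp (- inverse t)) has_real_derivative
        - real m * exp_bump (Suc m) t + exp_bump (m + 2) t) (at t)"
      using DERIV_mult[OF d1 d2] 1
      by (simp add: exp_bump_def y_def[symmetric] exp_minus divide_inverse mult_ac)
    then have "((\<lambda>t. inverse t ^ m / exp (inverse t)) has_real_derivative
        - real m * exp_bump (Suc m) t + exp_bump (m + 2) t) (at t)"
      by (simp add: exp_minus divide_inverse)
    then show ?thesis
      by (rule has_field_derivative_transform_within_open[where S = "{0<..}"])
        (use 1 in \<open>auto simp: exp_bump_def\<close>)
  next
    case 2
    have "((\<lambda>t. 0) has_real_derivative - real m * exp_bump (Suc m) t + exp_bump (m + 2) t) (at t)"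
      using 2 by (simp add: exp_bump_def)
    then show ?thesis
      by (rule has_field_derivative_transform_within_open[where S = "{..<0}"])
        (use 2 in \<open>auto simp: exp_bump_def\<close>)
  next
    case 3
    \<comment> \<open>At 0 the difference quotient is itself a member of the family, so its limit is
      already known to be 0.\<close>
    have "(\<lambda>h. (exp_bump m h - exp_bump m 0) / (h - 0)) = exp_bump (Suc m)"
      by (auto simp: fun_eq_iff exp_bump_def field_simps)
    then show ?thesis
      using tendsto_exp_bump_0[of "Suc m"]
      by (simp add: 3 has_field_derivative_iff) (simp add: exp_bump_def)
  qed
qed

text \<open>A class closed under directional derivatives; this is what makes every \<^const>\<open>Ck\<close> follow by induction.\<close>

inductive_set smooth :: "('a::euclidean_space \<Rightarrow> real) set" where
  const: "(\<lambda>x. c) \<in> smooth"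
| inner: "(\<lambda>x. x \<bullet> b) \<in> smooth"
| norm_sq: "(\<lambda>x. (x - a) \<bullet> (x - a)) \<in> smooth"
| add: "f \<in> smooth \<Longrightarrow> g \<in> smooth \<Longrightarrow> (\<lambda>x. f x + g x) \<in> smooth"
| mult: "f \<in> smooth \<Longrightarrow> g \<in> smooth \<Longrightarrow> (\<lambda>x. f x * g x) \<in> smooth"
| exp_bump: "f \<in> smooth \<Longrightarrow> (\<lambda>x. exp_bump m (f x)) \<in> smooth"
| sin: "f \<in> smooth \<Longrightarrow> (\<lambda>x. sin (f x)) \<in> smooth"
| cos: "f \<in> smooth \<Longrightarrow> (\<lambda>x. cos (f x)) \<in> smooth"

lemma smooth_chain:
  fixes f :: "'a::euclidean_space \<Rightarrow> real"
  assumes D: "\<And>x. (f has_derivative D x) (at x)" "\<And>b. (\<lambda>x. D x b) \<in> smooth"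
    and h: "\<And>t. (h has_real_derivative h' t) (at t)" and h': "(\<lambda>x. h' (f x)) \<in> smooth"
  shows "\<exists>D. (\<forall>x. ((\<lambda>x. h (f x)) has_derivative D x) (at x)) \<and> (\<forall>b. (\<lambda>x. D x b) \<in> smooth)"
proof (intro exI[of _ "\<lambda>x b. h' (f x) * D x b"] conjI allI)
  show "((\<lambda>x. h (f x)) has_derivative (\<lambda>b. h' (f x) * D x b)) (at x)" for x
    using has_derivative_compose[OF D(1) h[unfolded has_field_derivative_def]] by simp
  show "(\<lambda>x. h' (f x) * D x b) \<in> smooth" for b
    by (intro smooth.mult h' D(2))
qed

text \<open>Carrying the closure under all directional derivatives along with differentiability lets
  the induction for \<open>Ck\<close> apply again to each derivative.\<close>

lemma smooth_has_derivative:
  fixes f :: "'a::euclidean_space \<Rightarrow> real"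
  assumes "f \<in> smooth"
  shows "\<exists>D. (\<forall>x. (f has_derivative D x) (at x)) \<and> (\<forall>b. (\<lambda>x. D x b) \<in> smooth)"
  using assms
proof induction
  case (const c)
  show ?case
    by (intro exI[of _ "\<lambda>x h. 0"]) (auto intro: smooth.const)
next
  case (inner b)
  have "((\<lambda>x. x \<bullet> b) has_derivative (\<lambda>h. h \<bullet> b)) (at x)" for x :: 'a
    by (auto intro!: derivative_eq_intros)
  then show ?case
    by (intro exI[of _ "\<lambda>x h. h \<bullet> b"]) (auto intro: smooth.const)
next
  case (norm_sq a)
  have *: "((\<lambda>x. (x - a) \<bullet> (x - a)) has_derivative (\<lambda>h. 2 * (x \<bullet> h + - (a \<bullet> h)))) (at x)" for x :: 'a
    by (auto intro!: derivative_eq_intros simp: inner_diff_left inner_diff_right inner_commute)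
  show ?case
    by (intro exI[of _ "\<lambda>x h. 2 * (x \<bullet> h + - (a \<bullet> h))"] conjI allI *
        smooth.const smooth.inner smooth.add smooth.mult)
next
  case (add f g)
  then obtain D E where "\<And>x. (f has_derivative D x) (at x)" "\<And>b. (\<lambda>x. D x b) \<in> smooth"
    "\<And>x. (g has_derivative E x) (at x)" "\<And>b. (\<lambda>x. E x b) \<in> smooth"
    by blast
  then show ?case
    by (intro exI[of _ "\<lambda>x h. D x h + E x h"])
      (auto intro!: smooth.add has_derivative_add)
next
  case (mult f g)
  then obtain D E where "\<And>x. (f has_derivative D x) (at x)" "\<And>b. (\<lambda>x. D x b) \<in> smooth"
    "\<And>x. (g has_derivative E x) (at x)" "\<And>b. (\<lambda>x. E x b) \<in> smooth"
    by blast
  then show ?case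
    by (intro exI[of _ "\<lambda>x h. f x * E x h + D x h * g x"])
      (auto intro!: smooth.add smooth.mult mult.hyps has_derivative_mult)
next
  case (exp_bump f m)
  then obtain D where D: "\<And>x. (f has_derivative D x) (at x)" "\<And>b. (\<lambda>x. D x b) \<in> smooth" by blast
  show ?case
    by (rule smooth_chain[OF D DERIV_exp_bump])
      (intro smooth.add smooth.mult smooth.const smooth.exp_bump exp_bump.hyps)
next
  case (sin f)
  then obtain D where D: "\<And>x. (f has_derivative D x) (at x)" "\<And>b. (\<lambda>x. D x b) \<in> smooth" by blast
  show ?case
    by (rule smooth_chain[OF D DERIV_sin]) (intro smooth.cos sin.hyps)
next
  case (cos f)
  then obtain D where D: "\<And>x. (f has_derivative D x) (at x)" "\<And>b. (\<lambda>x. D x b) \<in> smooth" by blast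
  \<comment> \<open>The class has no rule for negation; it is obtained as a product with a
    constant.\<close>
  have "(\<lambda>x. - 1 * sin (f x)) \<in> smooth"
    by (intro smooth.mult smooth.const smooth.sin cos.hyps)
  then show ?case
    by (intro smooth_chain[OF D DERIV_cos]) simp
qed

lemma smooth_Ck: "f \<in> smooth \<Longrightarrow> Ck k f"
proof (induction k arbitrary: f)
  case (0 f)
  then obtain D where D: "\<And>x. (f has_derivative D x) (at x)"
    using smooth_has_derivative by blast
  have "continuous_on UNIV f"
    by (rule has_derivative_continuous_on) (rule has_derivative_at_withinI[OF D])
  then show ?case by simp
next
  case (Suc k f)
  then obtain D where D: "\<And>x. (f has_derivative D x) (at x)" "\<And>b. (\<lambda>x. D x b) \<in> smooth"
    using smooth_has_derivative by blast
  have "frechet_derivative f (at x) = D x" for x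
    by (rule frechet_derivative_at[OF D(1), symmetric])
  then show ?case
    using Suc.IH[OF D(2)] D(1) by (auto simp: differentiable_def)
qed

text \<open>The standard mollifier profile
  \<open>exp (- 1 / (1 - k\<^sup>2 * norm (x - z)\<^sup>2))\<close>, supported in the ball of radius
  \<open>1 / k\<close>. The sum with a negated coefficient matches the rules of
  \<open>smooth\<close>.\<close>

definition bump :: "'a::euclidean_space \<Rightarrow> real \<Rightarrow> 'a \<Rightarrow> real" where
  "bump z k x = exp_bump 0 (1 + - (k\<^sup>2) * ((x - z) \<bullet> (x - z)))"

lemma smooth_bump: "bump z k \<in> smooth"
  unfolding bump_def[abs_def]
  by (intro smooth.exp_bump smooth.add smooth.mult smooth.const smooth.norm_sq)

lemma bump_arg: "0 < k \<Longrightarrow> 1 + - (k\<^sup>2) * ((x - z) \<bullet> (x - z)) = 1 - (k * norm (x - z))\<^sup>2"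
  by (simp add: power_mult_distrib power2_norm_eq_inner)

text \<open>Stated for every \<open>m\<close> to cover both the bump, \<open>m = 0\<close>, and its
  gradient, \<open>m = 2\<close>.\<close>

lemma bump_eq_0:
  assumes "0 < k" "1 / k \<le> norm (x - z)"
  shows "exp_bump m (1 + - (k\<^sup>2) * ((x - z) \<bullet> (x - z))) = 0"
proof -
  have "1 \<le> k * norm (x - z)" using assms by (simp add: field_simps)
  then have "1 \<le> (k * norm (x - z))\<^sup>2" by simp
  then show ?thesis using assms(1) by (simp only: bump_arg exp_bump_def) auto
qed

lemma bump_bounds: "0 \<le> bump z k x" "bump z k x \<le> 1"
  by (simp_all add: bump_def exp_bump_nonneg exp_bump_0_le)

text \<open>On the half ball the argument of the profile is at least \<open>3 / 4\<close>, hence at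
  least \<open>1 / 2\<close>, so its inverse is at most 2; this is the origin of
  \<open>exp (- 2)\<close>.\<close>

lemma bump_lower:
  assumes k: "0 < k" and x: "norm (x - z) < 1 / (2 * k)"
  shows "exp (- 2) \<le> bump z k x"
proof -
  have "k * norm (x - z) \<le> 1 / 2" using k x by (simp add: field_simps)
  then have "(k * norm (x - z))\<^sup>2 \<le> (1 / 2)\<^sup>2" using k by (intro power_mono) auto
  then have t: "1 / 2 \<le> 1 - (k * norm (x - z))\<^sup>2" by (simp add: power2_eq_square)
  then have "inverse (1 - (k * norm (x - z))\<^sup>2) \<le> inverse (1 / 2)"
    by (intro le_imp_inverse_le) auto
  then have "exp (- 2) \<le> exp (- inverse (1 - (k * norm (x - z))\<^sup>2))" by simp
  also have "\<dots> = bump z k x"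
    unfolding bump_def bump_arg[OF k] using t by (simp add: exp_bump_def exp_minus inverse_eq_divide)
  finally show ?thesis .
qed

text \<open>For \<open>m = 0\<close> the first term of \<open>DERIV_exp_bump\<close> drops out and
  leaves \<open>exp_bump 2\<close>; the remaining factor is the inner derivative.\<close>

definition bump_gradient :: "'a::euclidean_space \<Rightarrow> real \<Rightarrow> 'a \<Rightarrow> 'a" where
  "bump_gradient z k x = (- 2 * k\<^sup>2 * exp_bump 2 (1 + - (k\<^sup>2) * ((x - z) \<bullet> (x - z)))) *\<^sub>R (x - z)"

lemma C1_gradient_bump: "C1_gradient (bump z k) (bump_gradient z k)"
  unfolding C1_gradient_def
proof (intro conjI allI)
  fix x
  have "((\<lambda>x. 1 + - (k\<^sup>2) * ((x - z) \<bullet> (x - z))) has_derivative (\<lambda>h. - 2 * k\<^sup>2 * ((x - z) \<bullet> h))) (at x)"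
    by (auto intro!: derivative_eq_intros simp: inner_commute)
  from has_derivative_compose[OF this DERIV_exp_bump[of 0, unfolded has_field_derivative_def]]
  show "(bump z k has_derivative (\<lambda>h. bump_gradient z k x \<bullet> h)) (at x)"
    by (simp add: bump_def[abs_def] bump_gradient_def mult_ac numeral_2_eq_2)
next
  have "(\<lambda>x. exp_bump 2 (1 + - (k\<^sup>2) * ((x - z) \<bullet> (x - z)))) \<in> smooth"
    by (intro smooth.exp_bump smooth.add smooth.mult smooth.const smooth.norm_sq)
  from smooth_Ck[OF this, of 0] show "continuous_on UNIV (bump_gradient z k)"
    unfolding bump_gradient_def[abs_def] by (intro continuous_intros) simp
qed

lemma norm_bump_gradient_le:
  assumes k: "0 < k"
  shows "norm (bump_gradient z k x) \<le> 4 * k"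
proof (cases "1 / k \<le> norm (x - z)")
  case True
  then show ?thesis using bump_eq_0[OF k True] k by (simp add: bump_gradient_def)
next
  case False
  have "norm (bump_gradient z k x) = 2 * k\<^sup>2 * exp_bump 2 (1 + - (k\<^sup>2) * ((x - z) \<bullet> (x - z))) * norm (x - z)"
    by (simp add: bump_gradient_def abs_mult exp_bump_nonneg)
  also have "\<dots> \<le> 2 * k\<^sup>2 * 2 * (1 / k)"
    using False k by (intro mult_mono exp_bump_2_le) (auto simp: exp_bump_nonneg)
  also have "\<dots> = 4 * k" using k by (simp add: power2_eq_square)
  finally show ?thesis .
qed

section \<open>Lower bounds at order one by testing weak gradients\<close>

text \<open>Young's inequality in the form \<open>t \<le> \<delta> + \<delta> powr (1 - q) * t powr q\<close> replaces Hoelder's.\<close>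

lemma integral_test_function_le:
  fixes g :: "'a::euclidean_space \<Rightarrow> 'a"
  assumes \<Omega>: "\<Omega> \<in> sets lebesgue" and K: "compact K" "K \<subseteq> \<Omega>" and q: "1 \<le> q" and \<delta>: "0 < \<delta>"
    and g: "locally_integrable \<Omega> g" and e: "norm e = 1"
    and \<phi>: "\<And>x. \<bar>\<phi> x\<bar> \<le> 1" "\<And>x. x \<notin> K \<Longrightarrow> \<phi> x = 0"
  shows "ennreal \<bar>\<integral>x. \<phi> x * (g x \<bullet> e) \<partial>lebesgue_on \<Omega>\<bar>
    \<le> ennreal (\<delta> * measure lebesgue K) +
      ennreal (\<delta> powr (1 - q)) * (\<integral>\<^sup>+x. ennreal (norm (g x) powr q) \<partial>lebesgue_on \<Omega>)"
\<comment> \<open>The integral of a non-integrable function is 0 by convention, which makes the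
  other case trivial.\<close>
proof (cases "integrable (lebesgue_on \<Omega>) (\<lambda>x. \<phi> x * (g x \<bullet> e))")
  case True
  \<comment> \<open>Local integrability makes \<open>g\<close> measurable only on compact sets. The
    cut-off to \<open>K\<close> is measurable on all of \<Omega>, and \<open>g\<close> itself
    returns at the end by monotonicity.\<close>
  define G where "G x = indicator K x *\<^sub>R g x" for x
  have "g absolutely_integrable_on K"
    using g K by (auto simp: locally_integrable_def)
  then have "G \<in> borel_measurable lebesgue"
    by (auto simp: G_def[abs_def] set_integrable_def)
  then have G[measurable]: "G \<in> borel_measurable (lebesgue_on \<Omega>)"
    by (rule measurable_restrict_space1)
  have Km: "K \<in> lmeasurable" using K by (simp add: lmeasurable_compact)
  then have KM[measurable]: "K \<in> sets (lebesgue_on \<Omega>)"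
    using \<Omega> K by (auto simp: sets_restrict_space_iff)
  have "ennreal \<bar>\<integral>x. \<phi> x * (g x \<bullet> e) \<partial>lebesgue_on \<Omega>\<bar> \<le> (\<integral>\<^sup>+x. ennreal (norm (\<phi> x * (g x \<bullet> e))) \<partial>lebesgue_on \<Omega>)"
    using integral_norm_bound_ennreal[OF True] by simp
  also have "\<dots> \<le> (\<integral>\<^sup>+x. ennreal \<delta> * indicator K x
      + ennreal (\<delta> powr (1 - q)) * ennreal (norm (G x) powr q) \<partial>lebesgue_on \<Omega>)"
  proof (rule nn_integral_mono)
    fix x
    show "ennreal (norm (\<phi> x * (g x \<bullet> e))) \<le> ennreal \<delta> * indicator K x
      + ennreal (\<delta> powr (1 - q)) * ennreal (norm (G x) powr q)"
    proof (cases "x \<in> K")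
      case True
      have "\<bar>\<phi> x\<bar> * \<bar>g x \<bullet> e\<bar> \<le> 1 * norm (g x)"
        using \<phi>(1) Cauchy_Schwarz_ineq2[of "g x" e] e by (intro mult_mono) auto
      also have "\<dots> \<le> \<delta> + \<delta> powr (1 - q) * norm (g x) powr q"
      \<comment> \<open>Small values are absorbed by \<delta>. For large ones, a factor
        \<open>\<delta> powr (q - 1)\<close> is replaced by
        \<open>norm (g x) powr (q - 1)\<close>.\<close>
      proof (cases "norm (g x) \<le> \<delta>")
        case True
        then show ?thesis by (simp add: add_increasing2)
      next
        case False
        have "\<delta> powr (q - 1) \<le> norm (g x) powr (q - 1)"
          using False \<delta> q by (intro powr_mono2) auto
        then have "\<delta> powr (1 - q) * \<delta> powr (q - 1) * norm (g x)
            \<le> \<delta> powr (1 - q) * norm (g x) powr (q - 1) * norm (g x)"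
          by (intro mult_right_mono mult_left_mono) auto
        moreover have "\<delta> powr (1 - q) * \<delta> powr (q - 1) = 1"
          using \<delta> by (simp add: powr_add[symmetric])
        moreover have "norm (g x) powr (q - 1) * norm (g x) = norm (g x) powr q"
          using False \<delta> by (simp add: powr_mult_base mult.commute)
        ultimately show ?thesis using \<delta> by (simp add: mult.assoc)
      qed
      finally have "ennreal (norm (\<phi> x * (g x \<bullet> e))) \<le> ennreal (\<delta> + \<delta> powr (1 - q) * norm (g x) powr q)"
        by (intro ennreal_leI) (simp add: abs_mult)
      also have "\<dots> = ennreal \<delta> + ennreal (\<delta> powr (1 - q)) * ennreal (norm (g x) powr q)"
        using \<delta> by (simp add: ennreal_mult')
      finally show ?thesis using True by (simp add: G_def)
    next
      case False
      then show ?thesis by (simp add: \<phi>(2))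
    qed
  qed
  also have "\<dots> = ennreal \<delta> * emeasure (lebesgue_on \<Omega>) K
      + ennreal (\<delta> powr (1 - q)) * (\<integral>\<^sup>+x. ennreal (norm (G x) powr q) \<partial>lebesgue_on \<Omega>)"
    using KM by (subst nn_integral_add) (auto simp: nn_integral_cmult)
  also have "\<dots> \<le> ennreal (\<delta> * measure lebesgue K)
      + ennreal (\<delta> powr (1 - q)) * (\<integral>\<^sup>+x. ennreal (norm (g x) powr q) \<partial>lebesgue_on \<Omega>)"
  proof (intro add_mono mult_left_mono nn_integral_mono)
    show "ennreal \<delta> * emeasure (lebesgue_on \<Omega>) K \<le> ennreal (\<delta> * measure lebesgue K)"
      using \<delta> emeasure_lebesgue_on_eq[OF \<Omega> Km K(2)] by (simp add: ennreal_mult')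
    show "ennreal (norm (G x) powr q) \<le> ennreal (norm (g x) powr q)" for x
      by (simp add: G_def indicator_def)
  qed auto
  finally show ?thesis .
qed (simp add: not_integrable_integral_eq)

lemma test_function_bump_mult:
  assumes f: "f \<in> smooth" and r: "0 < r" and K: "cball z r \<subseteq> \<Omega>"
  shows "test_function \<Omega> (\<lambda>x. bump z (1 / r) x * f x)"
proof -
  have "{x. bump z (1 / r) x * f x \<noteq> 0} \<subseteq> cball z r"
  proof
    fix x assume "x \<in> {x. bump z (1 / r) x * f x \<noteq> 0}"
    then have "bump z (1 / r) x \<noteq> 0" by auto
    then have "norm (x - z) < r"
      using bump_eq_0[of "1 / r" x z 0] r by (force simp: bump_def)
    then show "x \<in> cball z r" by (simp add: dist_norm norm_minus_commute)
  qed
  then have sub: "closure {x. bump z (1 / r) x * f x \<noteq> 0} \<subseteq> cball z r"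
    by (rule closure_minimal) auto
  then have "compact (closure {x. bump z (1 / r) x * f x \<noteq> 0})"
    using bounded_subset[OF bounded_cball] by (simp add: compact_eq_bounded_closed)
  moreover have "Ck k (\<lambda>x. bump z (1 / r) x * f x)" for k
    by (intro smooth_Ck smooth.mult smooth_bump f)
  ultimately show ?thesis
    using sub K by (auto simp: test_function_def)
qed

text \<open>Testing with \<open>\<beta> cos\<close> and \<open>\<beta> sin\<close>, the two pairings combine to
  \<open>A k \<integral>\<beta> (sin\<^sup>2 + cos\<^sup>2)\<close> without error terms.\<close>

lemma weak_gradient_oscillation_identity:
  fixes \<Omega> :: "'a::euclidean_space set"
  assumes \<Omega>: "\<Omega> \<in> sets lebesgue" and r: "0 < r" and K: "cball z r \<subseteq> \<Omega>" and e: "e \<in> Basis"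
    and g: "has_weak_gradient \<Omega> (\<lambda>x. A * sin (k * (x \<bullet> e))) g"
    and h: "has_weak_gradient \<Omega> (\<lambda>x. A * cos (k * (x \<bullet> e))) h"
  shows "A * k * (\<integral>x. bump z (1 / r) x \<partial>lborel) =
    (\<integral>x. (bump z (1 / r) x * cos (k * (x \<bullet> e))) * (g x \<bullet> e) \<partial>lebesgue_on \<Omega>) -
    (\<integral>x. (bump z (1 / r) x * sin (k * (x \<bullet> e))) * (h x \<bullet> e) \<partial>lebesgue_on \<Omega>)"
proof -
  define \<beta> where "\<beta> = bump z (1 / r)"
  define S where "S x = sin (k * (x \<bullet> e))" for x
  define C where "C x = cos (k * (x \<bullet> e))" for x
  have lin: "(\<lambda>x::'a. k * (x \<bullet> e)) \<in> smooth"
    by (intro smooth.mult smooth.const smooth.inner)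
  have SC: "S \<in> smooth" "C \<in> smooth"
    unfolding S_def[abs_def] C_def[abs_def] by (intro smooth.sin smooth.cos lin)+
  have ee: "e \<bullet> e = 1" using e by (simp add: inner_same_Basis)
  obtain D where D: "\<And>x. (\<beta> has_derivative D x) (at x)" "\<And>b. (\<lambda>x. D x b) \<in> smooth"
    using smooth_has_derivative[OF smooth_bump] unfolding \<beta>_def by blast
  have dS: "(S has_derivative (\<lambda>b. k * (b \<bullet> e) * C x)) (at x)"
    and dC: "(C has_derivative (\<lambda>b. - (k * (b \<bullet> e) * S x))) (at x)" for x
    unfolding S_def[abs_def] C_def[abs_def] by (auto intro!: derivative_eq_intros)
  have d\<phi>: "frechet_derivative (\<lambda>x. \<beta> x * C x) (at x) e = D x e * C x - k * \<beta> x * S x" for x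
    by (subst frechet_derivative_at[OF has_derivative_mult[OF D(1) dC], symmetric]) (simp add: ee)
  have d\<psi>: "frechet_derivative (\<lambda>x. \<beta> x * S x) (at x) e = D x e * S x + k * \<beta> x * C x" for x
    by (subst frechet_derivative_at[OF has_derivative_mult[OF D(1) dS], symmetric]) (simp add: ee)
  have T: "test_function \<Omega> (\<lambda>x. \<beta> x * C x)" "test_function \<Omega> (\<lambda>x. \<beta> x * S x)"
    unfolding \<beta>_def by (intro test_function_bump_mult SC r K)+
  have int: "integrable lborel F \<and> (\<integral>x. F x \<partial>lebesgue_on \<Omega>) = (\<integral>x. F x \<partial>lborel)"
    if Fs: "F \<in> smooth" and T\<phi>: "test_function \<Omega> \<phi>" and eq: "\<And>x. F x = f x * frechet_derivative \<phi> (at x) e" for F f \<phi>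
  proof -
    have cont: "continuous_on UNIV F" using smooth_Ck[OF Fs, of 0] by simp
    obtain R where "\<And>x. R < norm x \<Longrightarrow> frechet_derivative \<phi> (at x) e = 0"
      using test_functionD(5)[OF T\<phi>] by blast
    then have "integrable lborel F"
      using eq by (intro integrable_continuous_bounded_support[OF cont, of R]) auto
    moreover have "(\<integral>x. F x \<partial>lebesgue_on \<Omega>) = (\<integral>x. F x \<partial>lborel)"
      by (intro integral_lebesgue_on_eq_lborel \<Omega> borel_measurable_continuous_onI cont)
        (simp add: eq test_functionD(4)[OF T\<phi>])
    ultimately show ?thesis by blast
  qed
  define F1 where "F1 x = A * S x * (D x e * C x + - k * \<beta> x * S x)" for x
  define F2 where "F2 x = A * C x * (D x e * S x + k * \<beta> x * C x)" for x
  have F: "F1 \<in> smooth" "F2 \<in> smooth"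
    unfolding F1_def[abs_def] F2_def[abs_def] \<beta>_def
    by (intro smooth.add smooth.mult smooth.const SC D(2) smooth_bump)+
  have i1: "integrable lborel F1 \<and> (\<integral>x. F1 x \<partial>lebesgue_on \<Omega>) = (\<integral>x. F1 x \<partial>lborel)"
    by (rule int[OF F(1) T(1), of "\<lambda>x. A * S x"]) (simp add: F1_def d\<phi>)
  have i2: "integrable lborel F2 \<and> (\<integral>x. F2 x \<partial>lebesgue_on \<Omega>) = (\<integral>x. F2 x \<partial>lborel)"
    by (rule int[OF F(2) T(2), of "\<lambda>x. A * C x"]) (simp add: F2_def d\<psi>)
  have "(\<integral>x. F1 x \<partial>lborel) = - (\<integral>x. (\<beta> x * C x) * (g x \<bullet> e) \<partial>lebesgue_on \<Omega>)"
  proof -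
    have "(\<integral>x. A * S x * frechet_derivative (\<lambda>x. \<beta> x * C x) (at x) e \<partial>lebesgue_on \<Omega>)
        = - (\<integral>x. (\<beta> x * C x) * (g x \<bullet> e) \<partial>lebesgue_on \<Omega>)"
      using g T(1) e unfolding has_weak_gradient_def S_def by blast
    moreover have "A * S x * frechet_derivative (\<lambda>x. \<beta> x * C x) (at x) e = F1 x" for x
      by (simp add: F1_def d\<phi>)
    ultimately show ?thesis using i1 by simp
  qed
  moreover have "(\<integral>x. F2 x \<partial>lborel) = - (\<integral>x. (\<beta> x * S x) * (h x \<bullet> e) \<partial>lebesgue_on \<Omega>)"
  proof -
    have "(\<integral>x. A * C x * frechet_derivative (\<lambda>x. \<beta> x * S x) (at x) e \<partial>lebesgue_on \<Omega>)
        = - (\<integral>x. (\<beta> x * S x) * (h x \<bullet> e) \<partial>lebesgue_on \<Omega>)"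
      using h T(2) e unfolding has_weak_gradient_def C_def by blast
    moreover have "A * C x * frechet_derivative (\<lambda>x. \<beta> x * S x) (at x) e = F2 x" for x
      by (simp add: F2_def d\<psi>)
    ultimately show ?thesis using i2 by simp
  qed
  moreover have "(\<integral>x. F2 x \<partial>lborel) - (\<integral>x. F1 x \<partial>lborel) = (\<integral>x. F2 x - F1 x \<partial>lborel)"
    using i1 i2 by simp
  moreover have "F2 x - F1 x = A * k * \<beta> x" for x
  proof -
    \<comment> \<open>Both integrands contain \<open>A * S x * C x * D x e\<close>, so the
      derivative of the cut-off cancels in the difference.\<close>
    have "F2 x - F1 x = A * k * \<beta> x * ((S x)\<^sup>2 + (C x)\<^sup>2)"
      by (simp add: F1_def F2_def algebra_simps power2_eq_square)
    then show ?thesis by (simp add: S_def C_def)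
  qed
  ultimately show ?thesis by (simp add: \<beta>_def S_def C_def)
qed

lemma integral_bump_pos:
  assumes r: "0 < r"
  shows "0 < (\<integral>x. bump z (1 / r) x \<partial>lborel)"
proof -
  have cont: "continuous_on UNIV (bump z (1 / r))"
    using smooth_Ck[OF smooth_bump, of 0] by simp
  have "bump z (1 / r) x = 0" if "norm z + r < norm x" for x
    using bump_eq_0[of "1 / r" x z 0] that r norm_triangle_ineq2[of x z] by (simp add: bump_def)
  then have int: "integrable lborel (bump z (1 / r))"
    by (rule integrable_continuous_bounded_support[OF cont])
  have "0 < exp (- 2) * measure lborel (ball z (r / 2))"
    using r by (simp add: content_ball_pos)
  also have "\<dots> = (\<integral>x. exp (- 2) * indicator (ball z (r / 2)) x \<partial>lborel)"
    by simp
  also have "\<dots> \<le> (\<integral>x. bump z (1 / r) x \<partial>lborel)"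
  proof (rule integral_mono[OF _ int])
    show "integrable lborel (\<lambda>x. exp (- 2 :: real) * indicator (ball z (r / 2)) x)"
      by (intro integrable_mult_right integrable_real_indicator emeasure_bounded_finite) auto
    show "exp (- 2) * indicator (ball z (r / 2)) x \<le> bump z (1 / r) x" for x
      using bump_lower[of "1 / r" x z] r bump_bounds(1)[of z "1 / r" x]
      by (auto simp: indicator_def dist_norm norm_minus_commute)
  qed
  finally show ?thesis .
qed

text \<open>If both norms were below \<open>c\<close>, each pairing in the oscillation identity
  would be at most \<open>I / 4\<close>, so their difference at most \<open>I / 2\<close>; but it
  equals \<open>A * k * I\<close>, which is at least \<open>I\<close>.\<close>

lemma sobolev_norm_gradient_pair_lower:
  fixes \<Omega> :: "'a::euclidean_space set"
  assumes \<Omega>: "\<Omega> \<in> sets lebesgue" and r: "0 < r" and K: "cball z r \<subseteq> \<Omega>" and e: "e \<in> Basis"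
    and q: "1 \<le> q"
  shows "\<exists>c>0. \<forall>A k. 1 \<le> A * k \<longrightarrow>
    c \<le> sobolev_norm \<Omega> 1 (ereal q) (\<lambda>x. A * sin (k * (x \<bullet> e))) \<or>
    c \<le> sobolev_norm \<Omega> 1 (ereal q) (\<lambda>x. A * cos (k * (x \<bullet> e)))"
proof -
  define I where "I = (\<integral>x. bump z (1 / r) x \<partial>lborel)"
  define m where "m = measure lebesgue (cball z r)"
  have I: "0 < I" unfolding I_def by (rule integral_bump_pos[OF r])
  have m: "0 \<le> m" by (simp add: m_def)
  \<comment> \<open>The \<delta> term of Young's inequality is to cost at most \<open>I / 8\<close>;
    adding 1 to \<open>m\<close> keeps the denominator visibly positive.\<close>
  define \<delta> where "\<delta> = I / (8 * (m + 1))"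
  have \<delta>: "0 < \<delta>" using I m by (simp add: \<delta>_def)
  have \<delta>m: "\<delta> * m \<le> I / 8"
    using I m by (simp add: \<delta>_def field_simps)
  \<comment> \<open>Solves \<open>\<delta> powr (1 - q) * c powr q = I / 8\<close>, so that the
    second term of Young's inequality costs the same.\<close>
  define c where "c = (I / 8 / \<delta> powr (1 - q)) powr (1 / q)"
  have c: "0 < c" using I \<delta> by (simp add: c_def)
  have cq: "\<delta> powr (1 - q) * c powr q = I / 8"
    using I \<delta> q by (simp add: c_def powr_powr)
  have "ennreal c \<le> sobolev_norm \<Omega> 1 (ereal q) (\<lambda>x. A * sin (k * (x \<bullet> e))) \<or>
    ennreal c \<le> sobolev_norm \<Omega> 1 (ereal q) (\<lambda>x. A * cos (k * (x \<bullet> e)))"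
    if Ak: "1 \<le> A * k" for A k
  proof (rule ccontr)
    assume "\<not> ?thesis"
    then have lt: "sobolev_norm \<Omega> 1 (ereal q) (\<lambda>x. A * sin (k * (x \<bullet> e))) < ennreal c"
      "sobolev_norm \<Omega> 1 (ereal q) (\<lambda>x. A * cos (k * (x \<bullet> e))) < ennreal c"
      by auto
    \<comment> \<open>The strict inequality yields an actual weak gradient below \<open>c\<close>;
      no minimizer of the infimum is needed.\<close>
    have grad: "\<exists>g. has_weak_gradient \<Omega> v g \<and>
        (\<integral>\<^sup>+x. ennreal (norm (g x) powr q) \<partial>lebesgue_on \<Omega>) \<le> ennreal (c powr q)"
      if "sobolev_norm \<Omega> 1 (ereal q) v < ennreal c" for v
    proof -
      have "sobolev_seminorm \<Omega> 1 q v < ennreal c"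
        using sobolev_seminorm_le_sobolev_norm[of q 1 \<Omega> v] q that by (auto intro: le_less_trans)
      then obtain g where g: "has_weak_gradient \<Omega> v g" "Lp_norm \<Omega> (ereal q) g < ennreal c"
        by (auto simp: sobolev_seminorm_def INF_less_iff)
      have "ennreal_pow (Lp_norm \<Omega> (ereal q) g) q \<le> ennreal_pow (ennreal c) q"
        using g(2) q by (intro ennreal_pow_mono) auto
      then show ?thesis
        using g(1) q c by (auto simp: Lp_norm_real ennreal_pow_root ennreal_pow_def[of "ennreal c"])
    qed
    obtain g where g: "has_weak_gradient \<Omega> (\<lambda>x. A * sin (k * (x \<bullet> e))) g"
      "(\<integral>\<^sup>+x. ennreal (norm (g x) powr q) \<partial>lebesgue_on \<Omega>) \<le> ennreal (c powr q)"
      using grad[OF lt(1)] by blast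
    obtain h where h: "has_weak_gradient \<Omega> (\<lambda>x. A * cos (k * (x \<bullet> e))) h"
      "(\<integral>\<^sup>+x. ennreal (norm (h x) powr q) \<partial>lebesgue_on \<Omega>) \<le> ennreal (c powr q)"
      using grad[OF lt(2)] by blast
    have bound: "\<bar>\<integral>x. \<phi> x * (f x \<bullet> e) \<partial>lebesgue_on \<Omega>\<bar> \<le> I / 4"
      if f: "has_weak_gradient \<Omega> v f" "(\<integral>\<^sup>+x. ennreal (norm (f x) powr q) \<partial>lebesgue_on \<Omega>) \<le> ennreal (c powr q)"
        and \<phi>: "\<And>x. \<phi> x = bump z (1 / r) x * w x" "\<And>x. \<bar>w x\<bar> \<le> 1" for v f \<phi> and w :: "'a \<Rightarrow> real"
    proof -
      have "ennreal \<bar>\<integral>x. \<phi> x * (f x \<bullet> e) \<partial>lebesgue_on \<Omega>\<bar> \<le> ennreal (\<delta> * m)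
          + ennreal (\<delta> powr (1 - q)) * (\<integral>\<^sup>+x. ennreal (norm (f x) powr q) \<partial>lebesgue_on \<Omega>)"
        unfolding m_def
      proof (rule integral_test_function_le[OF \<Omega> _ K q \<delta>])
        show "\<bar>\<phi> x\<bar> \<le> 1" for x
          using \<phi> bump_bounds[of z "1 / r" x] by (simp add: abs_mult mult_le_one)
        show "\<phi> x = 0" if "x \<notin> cball z r" for x
          using that \<phi>(1) r bump_eq_0[of "1 / r" x z 0] by (simp add: bump_def dist_norm norm_minus_commute)
      qed (use f e in \<open>auto simp: has_weak_gradient_def\<close>)
      also have "\<dots> \<le> ennreal (I / 8) + ennreal (\<delta> powr (1 - q)) * ennreal (c powr q)"
        using \<delta>m by (intro add_mono mult_left_mono f(2) ennreal_leI) auto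
      also have "\<dots> = ennreal (I / 8) + ennreal (I / 8)"
        by (simp add: ennreal_mult'[symmetric] cq)
      also have "\<dots> = ennreal (I / 4)"
        using I by (subst ennreal_plus[symmetric]) auto
      finally show ?thesis using I by (simp add: ennreal_le_iff)
    qed
    have "\<bar>\<integral>x. (bump z (1 / r) x * cos (k * (x \<bullet> e))) * (g x \<bullet> e) \<partial>lebesgue_on \<Omega>\<bar> \<le> I / 4"
      by (rule bound[OF g]) auto
    moreover have "\<bar>\<integral>x. (bump z (1 / r) x * sin (k * (x \<bullet> e))) * (h x \<bullet> e) \<partial>lebesgue_on \<Omega>\<bar> \<le> I / 4"
      by (rule bound[OF h]) auto
    ultimately have "A * k * I \<le> I / 2"
      using weak_gradient_oscillation_identity[OF \<Omega> r K e g(1) h(1)] by (simp add: I_def)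
    moreover have "1 * I \<le> A * k * I"
      using Ak I by (intro mult_right_mono) auto
    ultimately show False using I by linarith
  qed
  then show ?thesis
    using c by (intro exI[of _ "ennreal c"]) auto
qed

subsection \<open>Concentrating and oscillating sequences\<close>

text \<open>Selecting for each \<open>k\<close> a member of the pair with large target norm
  preserves the bounds, and the limit 0 too, since the selection is dominated by
  \<open>\<bar>U k x\<bar> + \<bar>W k x\<bar>\<close>.\<close>

lemma not_compactly_embedded_pairI:
  fixes U W :: "nat \<Rightarrow> 'a::euclidean_space \<Rightarrow> real"
  assumes \<Omega>: "\<Omega> \<in> lmeasurable" and q: "1 \<le> q" and c: "0 < c"
    and X: "\<And>k. U k \<in> sobolev_space \<Omega> s p" "\<And>k. W k \<in> sobolev_space \<Omega> s p"
    and bdd: "\<And>k. sobolev_norm \<Omega> s p (U k) \<le> ennreal B" "\<And>k. sobolev_norm \<Omega> s p (W k) \<le> ennreal B"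
    and lower: "\<And>k. c \<le> sobolev_norm \<Omega> s' q (U k) \<or> c \<le> sobolev_norm \<Omega> s' q (W k)"
    and lim: "\<And>x. (\<lambda>k. U k x) \<longlonglongrightarrow> 0" "\<And>x. (\<lambda>k. W k x) \<longlonglongrightarrow> 0"
  shows "\<not> compactly_embedded (sobolev_space \<Omega> s p) (sobolev_norm \<Omega> s p)
            (sobolev_space \<Omega> s' q) (sobolev_norm \<Omega> s' q)"
proof -
  define V where "V k = (if c \<le> sobolev_norm \<Omega> s' q (U k) then U k else W k)" for k
  have "(\<lambda>k. V k x) \<longlonglongrightarrow> 0" for x
  proof (rule Lim_null_comparison)
    show "\<forall>\<^sub>F k in sequentially. norm (V k x) \<le> \<bar>U k x\<bar> + \<bar>W k x\<bar>"
      by (intro always_eventually) (simp add: V_def)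
    have "(\<lambda>k. \<bar>U k x\<bar> + \<bar>W k x\<bar>) \<longlonglongrightarrow> \<bar>0\<bar> + \<bar>0\<bar>"
      by (intro tendsto_intros lim)
    then show "(\<lambda>k. \<bar>U k x\<bar> + \<bar>W k x\<bar>) \<longlonglongrightarrow> 0" by simp
  qed
  moreover have "c \<le> sobolev_norm \<Omega> s' q (V k)" for k
    using lower[of k] by (auto simp: V_def)
  ultimately show ?thesis
    using X bdd by (intro not_compactly_embeddedI[OF \<Omega> q c, of V]) (auto simp: V_def)
qed

section \<open>The oscillating sequence\<close>

lemma sin_cos_diff_ge_1:
  fixes a b :: real
  assumes "2 \<le> b - a" "b - a \<le> 4"
  shows "1 \<le> \<bar>sin a - sin b\<bar> + \<bar>cos a - cos b\<bar>"
proof -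
  \<comment> \<open>The interval from 2 to 4 lies within \<open>pi / 2\<close> of \<open>pi\<close>,
    as \<open>3 < pi < 4\<close> already shows.\<close>
  have "0 \<le> cos (b - a - pi)"
    using assms pi_gt3 pi_less_4 by (intro cos_ge_zero) linarith+
  then have "cos (a - b) \<le> 0"
    by (simp add: cos_diff mult.commute)
  \<comment> \<open>The squared chord between two points of the unit circle; a nonpositive cosine
    makes it at least 2.\<close>
  moreover have "(sin a - sin b)\<^sup>2 + (cos a - cos b)\<^sup>2 = 2 - 2 * cos (a - b)"
    using sin_cos_squared_add[of a] sin_cos_squared_add[of b]
    by (simp add: power2_diff cos_diff algebra_simps)
  moreover have "(sin a - sin b)\<^sup>2 + (cos a - cos b)\<^sup>2 \<le> (\<bar>sin a - sin b\<bar> + \<bar>cos a - cos b\<bar>)\<^sup>2"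
    by (simp add: power2_sum[of "\<bar>sin a - sin b\<bar>"])
  ultimately have "1\<^sup>2 \<le> (\<bar>sin a - sin b\<bar> + \<bar>cos a - cos b\<bar>)\<^sup>2"
    unfolding power_one by linarith
  then show ?thesis by (rule power2_le_imp_le) auto
qed

text \<open>The shift and the radius move a point by less than \<open>3 / k + 1 / k \<le> r\<close>,
  which the margin between the radii \<open>r\<close> and \<open>2 * r\<close> accommodates.\<close>

lemma shifted_ball_subset:
  assumes "norm e = 1" "0 < k" "4 / k \<le> r" "cball z (2 * r) \<subseteq> \<Omega>" "x \<in> ball z r"
  shows "ball (x + (3 / k) *\<^sub>R e) (1 / k) \<subseteq> \<Omega>"
proof
  fix y assume "y \<in> ball (x + (3 / k) *\<^sub>R e) (1 / k)"
  then have "norm (y - (x + (3 / k) *\<^sub>R e)) < 1 / k"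
    by (simp add: dist_norm norm_minus_commute)
  moreover have "norm ((3 / k) *\<^sub>R e) = 3 / k" using assms by simp
  moreover have "norm (x - z) < r" using assms by (simp add: dist_norm norm_minus_commute)
  moreover have "y - z = (y - (x + (3 / k) *\<^sub>R e)) + (3 / k) *\<^sub>R e + (x - z)" by simp
  ultimately have "norm (y - z) < 1 / k + 3 / k + r"
    by (smt (verit) norm_triangle_ineq)
  moreover have "1 / k + 3 / k = 4 / k" by (simp add: add_divide_distrib[symmetric])
  ultimately have "norm (y - z) \<le> 2 * r" using assms by linarith
  then show "y \<in> \<Omega>" using assms(4) by (auto simp: dist_norm norm_minus_commute)
qed

text \<open>Projecting the shifted ball to the direction \<open>e\<close> gives a phase difference
  within 1 of 3, whatever the other coordinates are.\<close>

lemma separated_oscillation: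
  assumes e: "norm e = 1" and k: "0 < k" "4 / k \<le> r" and \<Omega>: "cball z (2 * r) \<subseteq> \<Omega>" and A: "0 \<le> A"
  shows "separated \<Omega> (\<lambda>x. A * sin (k * (x \<bullet> e))) (\<lambda>x. A * cos (k * (x \<bullet> e))) z r e k A"
  unfolding separated_def
proof (intro conjI ballI)
  show "0 < r" using k by (meson divide_pos_pos less_le_trans zero_less_numeral)
  then show "ball z r \<subseteq> \<Omega>" using \<Omega> by force
  fix x assume x: "x \<in> ball z r"
  show "ball (x + (3 / k) *\<^sub>R e) (1 / k) \<subseteq> \<Omega>"
    by (rule shifted_ball_subset[OF e k \<Omega> x])
  fix y assume "y \<in> ball (x + (3 / k) *\<^sub>R e) (1 / k)"
  then have "norm (y - (x + (3 / k) *\<^sub>R e)) < 1 / k"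
    by (simp add: dist_norm norm_minus_commute)
  then have "\<bar>(y - (x + (3 / k) *\<^sub>R e)) \<bullet> e\<bar> < 1 / k"
    using Cauchy_Schwarz_ineq2[of "y - (x + (3 / k) *\<^sub>R e)" e] e by auto
  moreover have "(y - (x + (3 / k) *\<^sub>R e)) \<bullet> e = y \<bullet> e - x \<bullet> e - 3 / k"
    using e by (simp add: inner_diff_left inner_add_left norm_eq_1)
  ultimately have "k * \<bar>y \<bullet> e - x \<bullet> e - 3 / k\<bar> < k * (1 / k)"
    using k by (intro mult_strict_left_mono) auto
  then have "\<bar>k * (y \<bullet> e - x \<bullet> e - 3 / k)\<bar> < 1"
    using k by (simp add: abs_mult)
  moreover have "k * (y \<bullet> e - x \<bullet> e - 3 / k) = k * (y \<bullet> e) - k * (x \<bullet> e) - 3"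
    using k by (simp add: algebra_simps)
  ultimately have "1 \<le> \<bar>sin (k * (x \<bullet> e)) - sin (k * (y \<bullet> e))\<bar> + \<bar>cos (k * (x \<bullet> e)) - cos (k * (y \<bullet> e))\<bar>"
    by (intro sin_cos_diff_ge_1) linarith+
  from mult_left_mono[OF this A]
  show "A \<le> \<bar>A * sin (k * (x \<bullet> e)) - A * sin (k * (y \<bullet> e))\<bar> + \<bar>A * cos (k * (x \<bullet> e)) - A * cos (k * (y \<bullet> e))\<bar>"
    using A by (simp add: distrib_left abs_mult right_diff_distrib[symmetric])
qed (use e k A in auto)

lemma C1_gradient_oscillation:
  "C1_gradient (\<lambda>x. A * sin (k * (x \<bullet> e))) (\<lambda>x. (A * k * cos (k * (x \<bullet> e))) *\<^sub>R e)"
  "C1_gradient (\<lambda>x. A * cos (k * (x \<bullet> e))) (\<lambda>x. (- (A * k * sin (k * (x \<bullet> e)))) *\<^sub>R e)"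
  unfolding C1_gradient_def
  by (auto intro!: derivative_eq_intros continuous_intros simp: inner_commute mult_ac)

lemma open_frequencies:
  fixes \<Omega> :: "'a::euclidean_space set"
  assumes "open \<Omega>" "\<Omega> \<noteq> {}"
  shows "\<exists>z r (\<kappa> :: nat \<Rightarrow> real). 0 < r \<and> cball z (2 * r) \<subseteq> \<Omega> \<and>
    (\<forall>n. 1 \<le> \<kappa> n) \<and> (\<forall>n. 4 / \<kappa> n \<le> r) \<and> filterlim \<kappa> at_top sequentially"
proof -
  obtain z where "z \<in> \<Omega>" using assms by auto
  then obtain R where R: "0 < R" "cball z R \<subseteq> \<Omega>"
    using assms(1) open_contains_cball by metis
  \<comment> \<open>The summand \<open>8 / R\<close> gives
    \<open>4 / \<kappa> n \<le> R / 2\<close>, which is the radius \<open>r\<close>, already at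
    \<open>n = 0\<close>; the summand 1 gives \<open>\<kappa> n \<ge> 1\<close>.\<close>
  define \<kappa> where "\<kappa> n = real n + (1 + 8 / R)" for n
  have "4 / \<kappa> n \<le> R / 2" "1 \<le> \<kappa> n" for n
  proof -
    have "8 / R \<le> \<kappa> n" by (simp add: \<kappa>_def)
    then have "4 / \<kappa> n \<le> 4 / (8 / R)"
      using R by (intro divide_left_mono mult_pos_pos) (auto simp: \<kappa>_def add_pos_pos add_nonneg_pos)
    then show "4 / \<kappa> n \<le> R / 2" by simp
    show "1 \<le> \<kappa> n" using R by (simp add: \<kappa>_def)
  qed
  moreover have "filterlim \<kappa> at_top sequentially"
    by (rule filterlim_at_top_mono[OF filterlim_real_sequentially])
      (use R in \<open>auto simp: \<kappa>_def\<close>)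
  ultimately show ?thesis
    using R by (intro exI[of _ z] exI[of _ "R / 2"] exI[of _ \<kappa>]) auto
qed

text \<open>The amplitude makes \<open>A n * \<kappa> n powr s = 1\<close>, so the source norms are
  bounded with carrier \<Omega>. The target requires three different lower bounds: Hoelder quotients
  for \<open>q = \<infinity>\<close>, weak gradients for \<open>s' = 1\<close>, and double integrals
  otherwise.\<close>

lemma not_compactly_embedded_higher_order:
  fixes \<Omega> :: "'a::euclidean_space set"
  assumes \<Omega>: "open \<Omega>" "bounded \<Omega>" "\<Omega> \<noteq> {}"
    and s: "0 < s" "s \<le> s'" "s' \<le> 1" and p: "1 \<le> p" and q: "1 \<le> q"
  shows "\<not> compactly_embedded
            (sobolev_space \<Omega> s (ereal p)) (sobolev_norm \<Omega> s (ereal p))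
            (sobolev_space \<Omega> s' q) (sobolev_norm \<Omega> s' q)"
proof -
  have \<Omega>L: "\<Omega> \<in> lmeasurable" using \<Omega> by (simp add: lmeasurable_open)
  then have \<Omega>S: "\<Omega> \<in> sets lebesgue" by auto
  obtain z r \<kappa> where r: "0 < r" and z: "cball z (2 * r) \<subseteq> \<Omega>"
    and \<kappa>': "\<forall>n::nat. 1 \<le> \<kappa> n" "\<forall>n. 4 / \<kappa> n \<le> r" "filterlim \<kappa> at_top sequentially"
    using open_frequencies[OF \<Omega>(1,3)] by (elim exE conjE) (rule that)
  note \<kappa> = \<kappa>'(1)[rule_format] \<kappa>'(2)[rule_format] \<kappa>'(3)
  have \<kappa>0: "0 < \<kappa> n" for n using \<kappa>(1)[of n] by linarith
  obtain e :: 'a where e: "e \<in> Basis" using nonempty_Basis by blast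
  then have e1: "norm e = 1" by simp
  define A where "A n = \<kappa> n powr (- s)" for n
  have A: "0 < A n" for n using \<kappa>0[of n] by (simp add: A_def)
  define U where "U n = (\<lambda>x. A n * sin (\<kappa> n * (x \<bullet> e)))" for n
  define W where "W n = (\<lambda>x. A n * cos (\<kappa> n * (x \<bullet> e)))" for n
  have A0: "A \<longlonglongrightarrow> 0"
    unfolding A_def[abs_def] using s(1) by (intro tendsto_neg_powr[OF _ \<kappa>(3)]) simp
  have A_pow: "A n * \<kappa> n powr t = \<kappa> n powr (t - s)" for n t
    by (simp add: A_def powr_add[symmetric])
  have A_ge: "1 \<le> A n * \<kappa> n powr s'" for n
    using \<kappa>(1)[of n] s by (simp add: A_pow ge_one_powr_ge_zero)
  obtain C where C: "0 \<le> C" "\<forall>(\<Omega>::'a set) S u G A k. C1_profile \<Omega> S u G A k \<longrightarrow>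
      u \<in> sobolev_space \<Omega> s (ereal p) \<and>
      sobolev_norm \<Omega> s (ereal p) u \<le> ennreal_root p (ennreal (C * ((A * k powr s) powr p * measure lebesgue S)))"
    using sobolev_norm_C1_profile_le[OF s(1) order_trans[OF s(2,3)] p, where 'a = 'a]
    by (elim exE conjE) (rule that)
  define B where "B = (max 0 (C * measure lebesgue \<Omega>)) powr (1 / p)"
  have bdd: "u \<in> sobolev_space \<Omega> s (ereal p) \<and> sobolev_norm \<Omega> s (ereal p) u \<le> ennreal B"
    if "C1_gradient u G" "\<forall>x. \<bar>u x\<bar> \<le> A n" "\<forall>x. norm (G x) \<le> A n * \<kappa> n" for u G n
  proof -
    have "A n * \<kappa> n powr s = 1" using \<kappa>0[of n] by (simp add: A_pow)
    then show ?thesis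
      using C(2)[rule_format, of \<Omega> \<Omega> u G "A n" "\<kappa> n"] \<Omega>L A[of n] \<kappa>(1)[of n] that
      by (simp add: C1_profile_def B_def ennreal_root_ennreal)
  qed
  have Ub: "U n \<in> sobolev_space \<Omega> s (ereal p) \<and> sobolev_norm \<Omega> s (ereal p) (U n) \<le> ennreal B" for n
    unfolding U_def using A[of n] \<kappa>0[of n] e1
    by (intro bdd[OF C1_gradient_oscillation(1)]) (auto simp: abs_mult intro: mult_left_le)
  have Wb: "W n \<in> sobolev_space \<Omega> s (ereal p) \<and> sobolev_norm \<Omega> s (ereal p) (W n) \<le> ennreal B" for n
    unfolding W_def using A[of n] \<kappa>0[of n] e1
    by (intro bdd[OF C1_gradient_oscillation(2)]) (auto simp: abs_mult intro: mult_left_le)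
  have sep: "separated \<Omega> (U n) (W n) z r e (\<kappa> n) (A n)" for n
    unfolding U_def W_def using A[of n] by (intro separated_oscillation e1 \<kappa>0 \<kappa> z) auto
  have cont: "continuous_on UNIV (U n)" "continuous_on UNIV (W n)" for n
    unfolding U_def W_def by (intro continuous_intros)+
  have "\<exists>c>0. \<forall>n. c \<le> sobolev_norm \<Omega> s' q (U n) \<or> c \<le> sobolev_norm \<Omega> s' q (W n)"
    using q
  proof (cases rule: ereal_ge_1_cases)
    case 1
    have "0 < ennreal (1 / 2 * (1 / 4) powr s')" by simp
    moreover have "ennreal (1 / 2 * (1 / 4) powr s') \<le> sobolev_norm \<Omega> s' q (U n) \<or>
        ennreal (1 / 2 * (1 / 4) powr s') \<le> sobolev_norm \<Omega> s' q (W n)" for n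
      unfolding 1 using s by (intro sobolev_norm_pair_lower_infinity[OF \<Omega>S _ sep A_ge]) auto
    ultimately show ?thesis by blast
  next
    case (2 t)
    show ?thesis
    proof (cases "s' = 1")
      case True
      have K: "cball z r \<subseteq> \<Omega>" using z r by auto
      obtain c where c: "0 < c" "\<forall>A k. 1 \<le> A * k \<longrightarrow>
          c \<le> sobolev_norm \<Omega> 1 (ereal t) (\<lambda>x. A * sin (k * (x \<bullet> e))) \<or>
          c \<le> sobolev_norm \<Omega> 1 (ereal t) (\<lambda>x. A * cos (k * (x \<bullet> e)))"
        using sobolev_norm_gradient_pair_lower[OF \<Omega>S r K e 2(2)] by (elim exE conjE) (rule that)
      have "1 \<le> A n * \<kappa> n" for n
        using A_ge[of n] True \<kappa>0[of n] by simp
      then have "c \<le> sobolev_norm \<Omega> s' q (U n) \<or> c \<le> sobolev_norm \<Omega> s' q (W n)" for n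
        unfolding 2 True U_def W_def by (rule c(2)[rule_format])
      then show ?thesis using c(1) by blast
    next
      case False
      \<comment> \<open>The region of separation is the fixed ball of radius \<open>r\<close>, so
        its volume factor can serve as the uniform lower bound.\<close>
      have t: "r powr real DIM('a) \<le> (A n * \<kappa> n powr s') powr t * r powr real DIM('a)" for n
        using mult_right_mono[OF ge_one_powr_ge_zero[OF A_ge[of n], of t], of "r powr real DIM('a)"] 2(2)
        by simp
      have "0 < r powr real DIM('a)" "0 < s'" "s' < 1" using r s False by auto
      note * = sobolev_norm_pair_lower[OF this(2,3) 2(2) this(1), where 'a = 'a]
      obtain c where c: "0 < c" "\<forall>(\<Omega>::'a set) u w z r' e k A. \<Omega> \<in> lmeasurable \<longrightarrow>
          continuous_on UNIV u \<longrightarrow> continuous_on UNIV w \<longrightarrow> separated \<Omega> u w z r' e k A \<longrightarrow>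
          r powr real DIM('a) \<le> (A * k powr s') powr t * r' powr real DIM('a) \<longrightarrow>
          c \<le> sobolev_norm \<Omega> s' (ereal t) u \<or> c \<le> sobolev_norm \<Omega> s' (ereal t) w"
        using * by (elim exE conjE) (rule that)
      have "c \<le> sobolev_norm \<Omega> s' q (U n) \<or> c \<le> sobolev_norm \<Omega> s' q (W n)" for n
        unfolding 2 by (rule c(2)[rule_format, OF \<Omega>L cont sep t])
      then show ?thesis using c(1) by blast
    qed
  qed
  then obtain c where c: "0 < c" "\<And>n. c \<le> sobolev_norm \<Omega> s' q (U n) \<or> c \<le> sobolev_norm \<Omega> s' q (W n)"
    by blast
  have lim: "(\<lambda>n. A n * b n) \<longlonglongrightarrow> 0" if "\<And>n. \<bar>b n\<bar> \<le> 1" for b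
  proof (rule Lim_null_comparison[OF _ A0])
    show "\<forall>\<^sub>F n in sequentially. norm (A n * b n) \<le> A n"
      by (intro always_eventually allI)
        (simp add: abs_mult abs_of_pos[OF A] mult_left_le[OF that less_imp_le[OF A]])
  qed
  show ?thesis
    using Ub Wb c(2)
    by (intro not_compactly_embedded_pairI[OF \<Omega>L q c(1), of U s "ereal p" W B])
      (auto simp: U_def W_def intro!: lim)
qed

section \<open>The concentrating sequence\<close>

lemma not_compactly_embedded_critical:
  fixes \<Omega> :: "'a::euclidean_space set"
  assumes \<Omega>: "open \<Omega>" "bounded \<Omega>" "\<Omega> \<noteq> {}"
    and s: "0 < s" "s \<le> 1" "0 \<le> s'" "s' < s" and p: "1 \<le> p" "s * p < real DIM('a)" and q: "1 \<le> q"
    and crit: "ereal (real DIM('a) * p / (real DIM('a) - (s - s') * p)) \<le> q"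
  shows "\<not> compactly_embedded
            (sobolev_space \<Omega> s (ereal p)) (sobolev_norm \<Omega> s (ereal p))
            (sobolev_space \<Omega> s' q) (sobolev_norm \<Omega> s' q)"
proof -
  define N where "N = real DIM('a)"
  \<comment> \<open>Determined by \<open>(a + s) * p = N\<close>: the growth of the height then
    balances the shrinking volume of the support.\<close>
  define a where "a = (N - s * p) / p"
  have a: "0 < a" using p by (simp add: a_def N_def)
  \<comment> \<open>Criticality in terms of scaling: multiplying out uses
    \<open>N - (s - s') * p = (a + s') * p\<close>, which is positive because
    \<open>s * p < N\<close>.\<close>
  have crit': "N \<le> (a + s') * t" if "q = ereal t" for t
  proof -
    have D: "0 < N - (s - s') * p"
    proof -
      have "0 \<le> s' * p" using p s by simp
      then show ?thesis using p by (simp add: N_def left_diff_distrib)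
    qed
    have "N * p / (N - (s - s') * p) \<le> t" using crit that by (simp add: N_def)
    then have "N * p \<le> t * (N - (s - s') * p)" using D by (simp add: pos_divide_le_eq)
    also have "N - (s - s') * p = (a + s') * p" using p by (simp add: a_def field_simps)
    finally have "N * p \<le> ((a + s') * t) * p" by (simp add: mult_ac)
    then show ?thesis using p by simp
  qed
  have \<Omega>L: "\<Omega> \<in> lmeasurable" using \<Omega> by (simp add: lmeasurable_open)
  then have \<Omega>S: "\<Omega> \<in> sets lebesgue" by auto
  obtain z r \<kappa> where r: "0 < r" and z: "cball z (2 * r) \<subseteq> \<Omega>"
    and \<kappa>': "\<forall>n::nat. 1 \<le> \<kappa> n" "\<forall>n. 4 / \<kappa> n \<le> r" "filterlim \<kappa> at_top sequentially"
    using open_frequencies[OF \<Omega>(1,3)] by (elim exE conjE) (rule that)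
  note \<kappa> = \<kappa>'(1)[rule_format] \<kappa>'(2)[rule_format] \<kappa>'(3)
  have \<kappa>0: "0 < \<kappa> n" for n using \<kappa>(1)[of n] by linarith
  obtain e :: 'a where e: "e \<in> Basis" using nonempty_Basis by blast
  then have e1: "norm e = 1" by simp
  define A where "A n = \<kappa> n powr a" for n
  have A: "0 < A n" for n using \<kappa>0[of n] by (simp add: A_def)
  define U where "U n = (\<lambda>x. A n * bump z (\<kappa> n) x)" for n
  have ball_sub: "ball z (1 / \<kappa> n) \<subseteq> \<Omega>" for n
  proof -
    have "1 / \<kappa> n \<le> 4 / \<kappa> n" using \<kappa>0[of n] by (simp add: divide_right_mono)
    then have "1 / \<kappa> n \<le> 2 * r" using \<kappa>(2)[of n] r by linarith
    then show ?thesis using z by force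
  qed
  have half_sub: "ball z (1 / (2 * \<kappa> n)) \<subseteq> \<Omega>" for n
  proof -
    have "1 / (2 * \<kappa> n) \<le> 1 / \<kappa> n" using \<kappa>0[of n] by (simp add: field_simps)
    then show ?thesis using ball_sub[of n] by force
  qed
  have U_out: "U n x = 0" if "1 / \<kappa> n \<le> norm (x - z)" for n x
    using bump_eq_0[OF \<kappa>0 that, of 0] by (simp add: U_def bump_def)
  have U_in: "A n * exp (- 2) \<le> U n x" if "x \<in> ball z (1 / (2 * \<kappa> n))" for n x
    unfolding U_def using that A[of n]
    by (intro mult_left_mono bump_lower \<kappa>0) (auto simp: dist_norm norm_minus_commute)
  have grad: "C1_gradient (U n) (\<lambda>x. A n *\<^sub>R bump_gradient z (\<kappa> n) x)" for n
    unfolding C1_gradient_def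
  proof (intro conjI allI)
    show "(U n has_derivative (\<lambda>h. A n *\<^sub>R bump_gradient z (\<kappa> n) x \<bullet> h)) (at x)" for x
      unfolding U_def inner_scaleR_left
      by (intro has_derivative_mult_right C1_gradient_has_derivative[OF C1_gradient_bump])
    show "continuous_on UNIV (\<lambda>x. A n *\<^sub>R bump_gradient z (\<kappa> n) x)"
      using C1_gradient_bump[of z "\<kappa> n"] by (auto simp: C1_gradient_def intro!: continuous_intros)
  qed
  have cont: "continuous_on UNIV (U n)" for n
    by (rule C1_gradient_continuous[OF grad])
  obtain C where C: "0 \<le> C" "\<forall>(\<Omega>::'a set) S u G A k. C1_profile \<Omega> S u G A k \<longrightarrow>
      u \<in> sobolev_space \<Omega> s (ereal p) \<and>
      sobolev_norm \<Omega> s (ereal p) u \<le> ennreal_root p (ennreal (C * ((A * k powr s) powr p * measure lebesgue S)))"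
    using sobolev_norm_C1_profile_le[OF s(1,2) p(1), where 'a = 'a] by (elim exE conjE) (rule that)
  define \<omega> where "\<omega> = measure lborel (ball (0::'a) 1)"
  have \<omega>: "0 < \<omega>" unfolding \<omega>_def by (simp add: content_ball_pos)
  define B where "B = (max 0 (C * (4 powr p * \<omega>))) powr (1 / p)"
  have bdd: "U n \<in> sobolev_space \<Omega> s (ereal p) \<and> sobolev_norm \<Omega> s (ereal p) (U n) \<le> ennreal B" for n
  proof -
    have "U n \<in> sobolev_space \<Omega> s (ereal p) \<and> sobolev_norm \<Omega> s (ereal p) (U n) \<le>
      ennreal_root p (ennreal (C * ((4 * A n * \<kappa> n powr s) powr p * measure lebesgue (ball z (1 / \<kappa> n)))))"
    \<comment> \<open>A profile has one amplitude for both the function and its gradient; the factor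
      4 in it comes from \<open>norm_bump_gradient_le\<close>.\<close>
    proof (rule C(2)[rule_format], unfold C1_profile_def, intro conjI allI ballI \<Omega>L ball_sub \<kappa>(1) grad)
      show "\<bar>U n x\<bar> \<le> 4 * A n" for x
        using A[of n] bump_bounds[of z "\<kappa> n" x] mult_left_le[of "bump z (\<kappa> n) x" "A n"]
        by (simp add: U_def abs_mult)
      show "norm (A n *\<^sub>R bump_gradient z (\<kappa> n) x) \<le> 4 * A n * \<kappa> n" for x
        using A[of n] norm_bump_gradient_le[OF \<kappa>0, of z n x] by simp
      show "U n x = 0" "A n *\<^sub>R bump_gradient z (\<kappa> n) x = 0" if "x \<in> \<Omega> - ball z (1 / \<kappa> n)" for x
        using that U_out[of n x] bump_eq_0[OF \<kappa>0, of n x z 2]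
        by (simp_all add: bump_gradient_def dist_norm norm_minus_commute)
    qed (use A[of n] grad[of n] in auto)
    moreover have "(4 * A n * \<kappa> n powr s) powr p * measure lebesgue (ball z (1 / \<kappa> n)) = 4 powr p * \<omega>"
    proof -
      have "(a + s) * p = N" using p by (simp add: a_def field_simps)
      then have "(A n * \<kappa> n powr s) powr p = \<kappa> n powr N"
        by (simp add: A_def powr_add[symmetric] powr_powr)
      moreover have "measure lebesgue (ball z (1 / \<kappa> n)) = \<omega> * (1 / \<kappa> n) powr N"
        using emeasure_lborel_ball[of "1 / \<kappa> n" z] \<kappa>0[of n] \<omega>
        by (intro measure_eq_emeasure_eq_ennreal) (simp_all add: \<omega>_def N_def)
      ultimately show ?thesis
        using \<kappa>0[of n] by (simp add: powr_mult powr_divide mult.assoc)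
    qed
    ultimately show ?thesis by (simp add: B_def ennreal_root_ennreal)
  qed
  \<comment> \<open>A single sequence suffices here, so both members of the pair are
    \<open>U n\<close>. On the half ball it has height at least \<open>A n * exp (- 2)\<close>, and
    at the shifted points it is 0.\<close>
  have sep: "separated \<Omega> (U n) (U n) z (1 / (2 * \<kappa> n)) e (\<kappa> n) (A n * exp (- 2))" for n
    unfolding separated_def
  proof (intro conjI ballI)
    fix x assume x: "x \<in> ball z (1 / (2 * \<kappa> n))"
    have "1 / (2 * \<kappa> n) \<le> 4 / \<kappa> n" using \<kappa>0[of n] by (simp add: field_simps)
    then have "x \<in> ball z r" using x \<kappa>(2)[of n] by auto
    then show "ball (x + (3 / \<kappa> n) *\<^sub>R e) (1 / \<kappa> n) \<subseteq> \<Omega>"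
      by (rule shifted_ball_subset[OF e1 \<kappa>0 \<kappa>(2) z])
    fix y assume "y \<in> ball (x + (3 / \<kappa> n) *\<^sub>R e) (1 / \<kappa> n)"
    then have "norm (x + (3 / \<kappa> n) *\<^sub>R e - y) < 1 / \<kappa> n" by (simp add: dist_norm)
    moreover have "norm ((3 / \<kappa> n) *\<^sub>R e) = 3 / \<kappa> n" using e1 \<kappa>0[of n] by simp
    moreover have "norm (z - x) < 1 / (2 * \<kappa> n)" using x by (simp add: dist_norm)
    moreover have "(3 / \<kappa> n) *\<^sub>R e = (x + (3 / \<kappa> n) *\<^sub>R e - y) + (y - z) + (z - x)" by simp
    ultimately have "3 / \<kappa> n < 1 / \<kappa> n + norm (y - z) + 1 / (2 * \<kappa> n)"
      by (smt (verit) norm_triangle_ineq)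
    \<comment> \<open>The left side is \<open>3 / (2 * \<kappa> n)\<close>, so \<open>y\<close> is
      beyond the support radius with room to spare.\<close>
    moreover have "3 / \<kappa> n - 1 / \<kappa> n - 1 / (2 * \<kappa> n) \<ge> 1 / \<kappa> n"
      using \<kappa>0[of n] by (simp add: field_simps)
    ultimately have "U n y = 0" by (intro U_out) linarith
    then show "A n * exp (- 2) \<le> \<bar>U n x - U n y\<bar> + \<bar>U n x - U n y\<bar>"
      using U_in[OF x] by simp
  qed (use \<kappa>0[of n] e1 A[of n] half_sub[of n] in auto)
  have A_ge: "1 \<le> A n * \<kappa> n powr s'" for n
    using \<kappa>(1)[of n] a s by (simp add: A_def powr_add[symmetric] ge_one_powr_ge_zero)
  \<comment> \<open>What is left of the lower bound after discarding
    \<open>\<kappa> n powr ((a + s') * t - N) \<ge> 1\<close>; the factors come from the height and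
    the radius on the half ball.\<close>
  define \<delta> where "\<delta> t = exp (- 2) powr t * (1 / 2) powr N" for t
  have \<delta>: "\<delta> t \<le> (A n * exp (- 2) * \<kappa> n powr s') powr t * (1 / (2 * \<kappa> n)) powr N"
    if "q = ereal t" for n t
  proof -
    have "1 \<le> \<kappa> n powr ((a + s') * t - N)"
      using \<kappa>(1)[of n] crit'[OF that] by (intro ge_one_powr_ge_zero) auto
    also have "\<dots> = (A n * \<kappa> n powr s') powr t * (1 / \<kappa> n) powr N"
      using \<kappa>0[of n] by (simp add: A_def powr_add[symmetric] powr_powr powr_diff powr_divide)
    finally have "\<delta> t * 1 \<le> \<delta> t * ((A n * \<kappa> n powr s') powr t * (1 / \<kappa> n) powr N)"
      by (intro mult_left_mono) (auto simp: \<delta>_def)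
    then show ?thesis by (simp add: \<delta>_def powr_mult powr_divide mult_ac)
  qed
  have "\<exists>c>0. \<forall>n. c \<le> sobolev_norm \<Omega> s' q (U n)"
    using q
  proof (cases rule: ereal_ge_1_cases)
    case 1
    show ?thesis
    proof (cases "s' = 0")
      case True
      have "ennreal (exp (- 2)) \<le> sobolev_norm \<Omega> s' q (U n)" for n
      proof -
        \<comment> \<open>The essential supremum is tested at one point of the half ball off the
          exceptional set.\<close>
        have "AE x in lebesgue_on \<Omega>. ennreal (norm (U n x)) \<le> Lp_norm \<Omega> \<infinity> (U n)"
          unfolding Lp_norm_infinity by (rule esssup_AE)
        then obtain x where x: "x \<in> ball z (1 / (2 * \<kappa> n))" "ennreal (norm (U n x)) \<le> Lp_norm \<Omega> \<infinity> (U n)"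
          using AE_lebesgue_on_obtain[OF \<Omega>S _ half_sub] \<kappa>0[of n]
          by (metis divide_pos_pos mult_pos_pos zero_less_numeral zero_less_one)
        have "1 * exp (- 2) \<le> A n * exp (- 2)"
          using A_ge[of n] True \<kappa>0[of n] by (intro mult_right_mono) auto
        then have "ennreal (exp (- 2)) \<le> ennreal (norm (U n x))"
          using U_in[OF x(1)] by (intro ennreal_leI, unfold real_norm_def) linarith
        also have "\<dots> \<le> sobolev_norm \<Omega> s' q (U n)"
          using x(2) True 1 by (simp add: sobolev_norm_def)
        finally show ?thesis .
      qed
      then show ?thesis by (intro exI[of _ "ennreal (exp (- 2))"]) auto
    next
      case False
      have "exp (- 2) \<le> A n * exp (- 2) * \<kappa> n powr s'" for n
        using A_ge[of n] mult_right_mono[OF A_ge[of n], of "exp (- 2)"] by (simp add: mult_ac)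
      from sobolev_norm_pair_lower_infinity[OF \<Omega>S _ sep this]
      have "ennreal (exp (- 2) / 2 * (1 / 4) powr s') \<le> sobolev_norm \<Omega> s' q (U n)" for n
        unfolding 1 using False s by auto
      then show ?thesis
        by (intro exI[of _ "ennreal (exp (- 2) / 2 * (1 / 4) powr s')"]) auto
    qed
  next
    case (2 t)
    show ?thesis
    proof (cases "s' = 0")
      case True
      have "ennreal_root t (ennreal (\<omega> * \<delta> t)) \<le> sobolev_norm \<Omega> s' q (U n)" for n
      proof -
        let ?b = "ball z (1 / (2 * \<kappa> n))"
        have "ennreal (\<omega> * \<delta> t) \<le> ennreal ((A n * exp (- 2)) powr t * (\<omega> * (1 / (2 * \<kappa> n)) powr N))"
          using \<delta>[OF 2(1), of n] True \<omega> \<kappa>0[of n] by (intro ennreal_leI) (simp add: mult_ac)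
        also have "\<dots> = ennreal ((A n * exp (- 2)) powr t) * emeasure (lebesgue_on \<Omega>) ?b"
          using emeasure_lborel_ball[of "1 / (2 * \<kappa> n)" z] \<kappa>0[of n] \<Omega>S half_sub[of n]
          by (simp add: emeasure_restrict_space \<omega>_def N_def ennreal_mult')
        also have "\<dots> = (\<integral>\<^sup>+x. ennreal ((A n * exp (- 2)) powr t) * indicator ?b x \<partial>lebesgue_on \<Omega>)"
          using half_sub[of n] \<Omega>S
          by (intro nn_integral_cmult_indicator[symmetric]) (simp add: sets_restrict_space_iff)
        also have "\<dots> \<le> (\<integral>\<^sup>+x. ennreal (norm (U n x) powr t) \<partial>lebesgue_on \<Omega>)"
        proof (rule nn_integral_mono)
          fix x
          show "ennreal ((A n * exp (- 2)) powr t) * indicator ?b x \<le> ennreal (norm (U n x) powr t)"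
          proof (cases "x \<in> ?b")
            case True
            then show ?thesis
              using U_in[OF True] A[of n] 2(2) by (auto intro!: ennreal_leI powr_mono2)
          qed auto
        qed
        finally have "ennreal_root t (ennreal (\<omega> * \<delta> t)) \<le> Lp_norm \<Omega> q (U n)"
          using 2 by (simp add: Lp_norm_real ennreal_root_mono)
        then show ?thesis using True by (simp add: sobolev_norm_def)
      qed
      moreover have "0 < ennreal_root t (ennreal (\<omega> * \<delta> t))"
        using \<omega> by (simp add: ennreal_root_ennreal \<delta>_def)
      ultimately show ?thesis by blast
    next
      case False
      have "0 < \<delta> t" "0 < s'" "s' < 1" using s False by (auto simp: \<delta>_def)
      note * = sobolev_norm_pair_lower[OF this(2,3) 2(2) this(1), where 'a = 'a]
      obtain c where c: "0 < c" "\<forall>(\<Omega>::'a set) u w z r e k A. \<Omega> \<in> lmeasurable \<longrightarrow>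
          continuous_on UNIV u \<longrightarrow> continuous_on UNIV w \<longrightarrow> separated \<Omega> u w z r e k A \<longrightarrow>
          \<delta> t \<le> (A * k powr s') powr t * r powr real DIM('a) \<longrightarrow>
          c \<le> sobolev_norm \<Omega> s' (ereal t) u \<or> c \<le> sobolev_norm \<Omega> s' (ereal t) w"
        using * by (elim exE conjE) (rule that)
      have "c \<le> sobolev_norm \<Omega> s' q (U n)" for n
        unfolding 2 using c(2)[rule_format, OF \<Omega>L cont cont sep \<delta>[OF 2(1), unfolded N_def], of n] by simp
      then show ?thesis using c(1) by blast
    qed
  qed
  then obtain c where c: "0 < c" "\<And>n. c \<le> sobolev_norm \<Omega> s' q (U n)" by blast
  \<comment> \<open>At \<open>z\<close> itself the values grow without bound; elsewhere the
    shrinking support eventually misses \<open>x\<close>.\<close>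
  have lim: "(\<lambda>n. U n x) \<longlonglongrightarrow> 0" if "x \<noteq> z" for x
  proof (rule tendsto_eventually)
    have "\<forall>\<^sub>F n in sequentially. 1 / norm (x - z) \<le> \<kappa> n"
      using \<kappa>(3) by (simp add: filterlim_at_top)
    then show "\<forall>\<^sub>F n in sequentially. U n x = 0"
    proof eventually_elim
      case (elim n)
      then show ?case
        using \<kappa>0[of n] that by (intro U_out) (simp add: field_simps)
    qed
  qed
  have "AE x in lebesgue. x \<noteq> z"
    by (intro AE_completion AE_lborel_singleton)
  then have "AE x in lebesgue_on \<Omega>. x \<noteq> z"
    using \<Omega>S by (auto simp: AE_restrict_space_iff elim: eventually_mono)
  then have "AE x in lebesgue_on \<Omega>. (\<lambda>n. U n x) \<longlonglongrightarrow> 0"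
    by eventually_elim (rule lim)
  then show ?thesis
    using bdd c(2) by (intro not_compactly_embeddedI[OF \<Omega>L q c(1), of U]) auto
qed

theorem proposition2p10:
  fixes \<Omega> :: "'a::euclidean_space set"
    and s p s' :: real
    and p' :: ereal
  assumes "0 < s" and "s \<le> 1"
    and "1 \<le> p"
    and "s * p < real DIM('a)"
    and "s \<noteq> p"
    and "bounded_lipschitz_domain \<Omega>"
    and "0 \<le> s'" and "s' \<le> 1"
    and "1 \<le> p'"
    and "\<not> ((0 \<le> s' \<and> s' < s) \<and>
            (1 \<le> p' \<and> p' < ereal (real DIM('a) * p / (real DIM('a) - (s - s') * p))))"
  shows "\<not> compactly_embedded
            (sobolev_space \<Omega> s (ereal p)) (sobolev_norm \<Omega> s (ereal p))
            (sobolev_space \<Omega> s' p') (sobolev_norm \<Omega> s' p')"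
proof -
  have \<Omega>: "open \<Omega>" "bounded \<Omega>" "\<Omega> \<noteq> {}"
    using assms by (auto simp: bounded_lipschitz_domain_def)
  show ?thesis
  \<comment> \<open>The admissible range can fail in only two ways: \<open>s' \<ge> s\<close>, or
    \<open>s' < s\<close> with \<open>p'\<close> at least critical.\<close>
  proof (cases "s' < s")
    case True
    then have "ereal (real DIM('a) * p / (real DIM('a) - (s - s') * p)) \<le> p'"
      using assms by (auto simp: not_less)
    then show ?thesis
      using assms True by (intro not_compactly_embedded_critical \<Omega>)
  next
    case False
    then show ?thesis
      using assms by (intro not_compactly_embedded_higher_order \<Omega>) auto
  qed
qed

end
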